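(* Let $n\geq 2$ be an integer and let $\mathcal{O}_n$ be the Cuntz algebra. There exist simple C*-subalgebras $B_1,B_2\subset\mathcal{O}_n$ of finite Watatani index such that $B_1\subsetneq B_2$ and $\mathrm{Aut}_{B_1}(\mathcal{O}_n)=\mathrm{Aut}_{B_2}(\mathcal{O}_n)$.
   Context: $\mathcal{O}_n$ is the universal unital C*-algebra generated by isometries $S_1,\dots,S_n$ with $S_i^*S_j=\delta_{i,j}1$ and $\sum_{k=1}^n S_kS_k^*=1$. For C*-algebras $B\subset A$, $\mathrm{Aut}_B(A)=\{\varphi\in\mathrm{Aut}(A):\varphi(b)=b\text{ for all }b\in B\}$. A C*-subalgebra $B\subset A$ has finite Watatani index if there is a conditional expectation $E\colon A\to B$ admitting a quasi-basis, i.e. a finite family $\{(u_i,v_i)\}_{i=1}^m\subset A\times A$ with $x=\sum_{i=1}^m u_iE(v_ix)=\sum_{i=1}^mE(xu_i)v_i$ for all $x\in A$; its Watatani index is then $\mathrm{Ind}\,E=\sum_{i=1}^m u_iv_i$. *)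

theory Defs
  imports "HOL-Analysis.Analysis" "HOL-Algebra.RingHom"
begin

section \<open>Unital C*-algebras as a type class\<close>

text \<open>Nonzero unital C*-algebras; \<open>norm 1 = 1\<close> comes from \<open>real_normed_algebra_1\<close>.
  The real scalar multiplication of the library is the restriction of \<open>scaleC\<close>.\<close>

class unital_cstar_algebra = real_normed_algebra_1 + banach +
  fixes scaleC :: "complex \<Rightarrow> 'a \<Rightarrow> 'a" (infixr "*\<^sub>C" 75)
    and adj :: "'a \<Rightarrow> 'a"
  assumes scaleC_add_right: "c *\<^sub>C (x + y) = c *\<^sub>C x + c *\<^sub>C y"
    and scaleC_add_left: "(c + d) *\<^sub>C x = c *\<^sub>C x + d *\<^sub>C x"
    and scaleC_scaleC: "c *\<^sub>C (d *\<^sub>C x) = (c * d) *\<^sub>C x"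
    and scaleR_scaleC: "r *\<^sub>R x = complex_of_real r *\<^sub>C x"
    and mult_scaleC_left: "(c *\<^sub>C x) * y = c *\<^sub>C (x * y)"
    and mult_scaleC_right: "x * (c *\<^sub>C y) = c *\<^sub>C (x * y)"
    and norm_scaleC: "norm (c *\<^sub>C x) = cmod c * norm x"
    and adj_add: "adj (x + y) = adj x + adj y"
    and adj_scaleC: "adj (c *\<^sub>C x) = cnj c *\<^sub>C adj x"
    and adj_mult: "adj (x * y) = adj y * adj x"
    and adj_adj: "adj (adj x) = x"
    and cstar_identity: "norm (adj x * x) = (norm x)\<^sup>2"

instantiation complex :: unital_cstar_algebra
begin

definition scaleC_complex :: "complex \<Rightarrow> complex \<Rightarrow> complex"
  where "scaleC_complex c x = c * x"

definition adj_complex :: "complex \<Rightarrow> complex"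
  where "adj_complex x = cnj x"

instance
  by standard
    (auto simp: scaleC_complex_def adj_complex_def algebra_simps scaleR_conv_of_real
      norm_mult power2_eq_square)

end

section \<open>Unital C*-algebras on a carrier set\<close>

text \<open>A universal property quantifies over all C*-algebras inside a formula, where one cannot
  quantify over types. The target algebras are therefore given by records with a carrier;
  the zero algebra is allowed here.\<close>

record 'b cstar_structure = "'b ring" +
  cscale :: "complex \<Rightarrow> 'b \<Rightarrow> 'b"
  cadj :: "'b \<Rightarrow> 'b"
  cnorm :: "'b \<Rightarrow> real"

locale unital_cstar_structure = ring B for B :: "'b cstar_structure" (structure) +
  assumes cscale_closed: "x \<in> carrier B \<Longrightarrow> cscale B c x \<in> carrier B"
    and cscale_add_right: "\<lbrakk>x \<in> carrier B; y \<in> carrier B\<rbrakk>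
      \<Longrightarrow> cscale B c (x \<oplus> y) = cscale B c x \<oplus> cscale B c y"
    and cscale_add_left: "x \<in> carrier B \<Longrightarrow> cscale B (c + d) x = cscale B c x \<oplus> cscale B d x"
    and cscale_cscale: "x \<in> carrier B \<Longrightarrow> cscale B c (cscale B d x) = cscale B (c * d) x"
    and cscale_one: "x \<in> carrier B \<Longrightarrow> cscale B 1 x = x"
    and mult_cscale_left: "\<lbrakk>x \<in> carrier B; y \<in> carrier B\<rbrakk>
      \<Longrightarrow> cscale B c x \<otimes> y = cscale B c (x \<otimes> y)"
    and mult_cscale_right: "\<lbrakk>x \<in> carrier B; y \<in> carrier B\<rbrakk>
      \<Longrightarrow> x \<otimes> cscale B c y = cscale B c (x \<otimes> y)"
    and cnorm_eq_0_iff: "x \<in> carrier B \<Longrightarrow> cnorm B x = 0 \<longleftrightarrow> x = \<zero>"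
    and cnorm_nonneg: "x \<in> carrier B \<Longrightarrow> 0 \<le> cnorm B x"
    and cnorm_triangle: "\<lbrakk>x \<in> carrier B; y \<in> carrier B\<rbrakk>
      \<Longrightarrow> cnorm B (x \<oplus> y) \<le> cnorm B x + cnorm B y"
    and cnorm_cscale: "x \<in> carrier B \<Longrightarrow> cnorm B (cscale B c x) = cmod c * cnorm B x"
    and cnorm_mult: "\<lbrakk>x \<in> carrier B; y \<in> carrier B\<rbrakk>
      \<Longrightarrow> cnorm B (x \<otimes> y) \<le> cnorm B x * cnorm B y"
    and cnorm_complete: "\<lbrakk>\<And>k. X k \<in> carrier B;
        \<And>e. e > 0 \<Longrightarrow> \<exists>N. \<forall>k\<ge>N. \<forall>l\<ge>N. cnorm B (X k \<ominus> X l) < e\<rbrakk>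
      \<Longrightarrow> \<exists>L\<in>carrier B. (\<lambda>k. cnorm B (X k \<ominus> L)) \<longlonglongrightarrow> 0"
    and cadj_closed: "x \<in> carrier B \<Longrightarrow> cadj B x \<in> carrier B"
    and cadj_add: "\<lbrakk>x \<in> carrier B; y \<in> carrier B\<rbrakk> \<Longrightarrow> cadj B (x \<oplus> y) = cadj B x \<oplus> cadj B y"
    and cadj_cscale: "x \<in> carrier B \<Longrightarrow> cadj B (cscale B c x) = cscale B (cnj c) (cadj B x)"
    and cadj_mult: "\<lbrakk>x \<in> carrier B; y \<in> carrier B\<rbrakk> \<Longrightarrow> cadj B (x \<otimes> y) = cadj B y \<otimes> cadj B x"
    and cadj_cadj: "x \<in> carrier B \<Longrightarrow> cadj B (cadj B x) = x"
    and cstar_identity: "x \<in> carrier B \<Longrightarrow> cnorm B (cadj B x \<otimes> x) = (cnorm B x)\<^sup>2"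

definition cstar_of :: "'a::unital_cstar_algebra cstar_structure" where
  "cstar_of = \<lparr>carrier = UNIV, monoid.mult = (*), one = 1, ring.zero = 0, add = (+),
     cscale = scaleC, cadj = adj, cnorm = norm\<rparr>"

lemma cstar_of_simps [simp]:
  "carrier cstar_of = UNIV"
  "x \<otimes>\<^bsub>cstar_of\<^esub> y = x * y"
  "\<one>\<^bsub>cstar_of\<^esub> = 1"
  "\<zero>\<^bsub>cstar_of\<^esub> = 0"
  "x \<oplus>\<^bsub>cstar_of\<^esub> y = x + y"
  "cscale cstar_of c x = c *\<^sub>C x"
  "cadj cstar_of x = adj x"
  "cnorm cstar_of x = norm x"
  by (simp_all add: cstar_of_def)

lemma ring_cstar_of: "ring (cstar_of :: 'a::unital_cstar_algebra cstar_structure)"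
proof (rule ringI)
  show "abelian_group (cstar_of :: 'a cstar_structure)"
    by (rule abelian_groupI) (auto simp: algebra_simps add_eq_0_iff)
  show "monoid (cstar_of :: 'a cstar_structure)"
    by (rule monoidI) (auto simp: algebra_simps)
qed (auto simp: algebra_simps)

lemma a_minus_cstar_of [simp]:
  fixes x y :: "'a::unital_cstar_algebra"
  shows "x \<ominus>\<^bsub>cstar_of\<^esub> y = x - y"
proof -
  interpret ring "cstar_of :: 'a cstar_structure" by (rule ring_cstar_of)
  have "\<ominus>\<^bsub>cstar_of\<^esub> y = - y"
    by (rule minus_equality) auto
  then show ?thesis by (simp add: a_minus_def)
qed

lemma finsum_cstar_of [simp]:
  fixes f :: "'i \<Rightarrow> 'a::unital_cstar_algebra"
  shows "finsum cstar_of f I = sum f I"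
proof -
  interpret ring "cstar_of :: 'a cstar_structure" by (rule ring_cstar_of)
  show ?thesis
    by (induction I rule: infinite_finite_induct) (simp_all add: finsum_infinite)
qed

lemma unital_cstar_structure_cstar_of:
  "unital_cstar_structure (cstar_of :: 'a::unital_cstar_algebra cstar_structure)"
proof -
  interpret ring "cstar_of :: 'a cstar_structure" by (rule ring_cstar_of)
  have one: "1 *\<^sub>C x = x" for x :: 'a
    using scaleR_scaleC[of 1 x] by simp
  have complete: "\<exists>L. (\<lambda>k. norm (X k - L)) \<longlonglongrightarrow> 0"
    if "\<And>e. e > 0 \<Longrightarrow> \<exists>N. \<forall>k\<ge>N. \<forall>l\<ge>N. norm (X k - X l) < e" for X :: "nat \<Rightarrow> 'a"
  proof -
    have "Cauchy X"
      using that by (intro CauchyI) blast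
    then obtain L where "X \<longlonglongrightarrow> L"
      using Cauchy_convergent_iff convergent_def by blast
    then show ?thesis
      using LIM_zero tendsto_norm_zero by blast
  qed
  show ?thesis
    by unfold_locales
      (auto simp: scaleC_add_right scaleC_add_left scaleC_scaleC one mult_scaleC_left
        mult_scaleC_right norm_triangle_ineq norm_scaleC norm_mult_ineq adj_add adj_scaleC
        adj_mult adj_adj unital_cstar_algebra_class.cstar_identity intro: complete)
qed

definition cstar_hom :: "'a cstar_structure \<Rightarrow> 'b cstar_structure \<Rightarrow> ('a \<Rightarrow> 'b) \<Rightarrow> bool" where
  "cstar_hom A B \<phi> \<longleftrightarrow> \<phi> \<in> ring_hom A B \<and>
     (\<forall>c. \<forall>x\<in>carrier A. \<phi> (cscale A c x) = cscale B c (\<phi> x)) \<and>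
     (\<forall>x\<in>carrier A. \<phi> (cadj A x) = cadj B (\<phi> x))"

section \<open>C*-subalgebras, simplicity and the Watatani index\<close>

definition complex_subspace :: "'a::unital_cstar_algebra set \<Rightarrow> bool" where
  "complex_subspace B \<longleftrightarrow> 0 \<in> B \<and> (\<forall>x\<in>B. \<forall>y\<in>B. x + y \<in> B) \<and> (\<forall>c. \<forall>x\<in>B. c *\<^sub>C x \<in> B)"

text \<open>A C*-subalgebra need not contain the unit of the ambient algebra.\<close>

definition cstar_subalgebra :: "'a::unital_cstar_algebra set \<Rightarrow> bool" where
  "cstar_subalgebra B \<longleftrightarrow> complex_subspace B \<and> closed B \<and>
     (\<forall>x\<in>B. \<forall>y\<in>B. x * y \<in> B) \<and> (\<forall>x\<in>B. adj x \<in> B)"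

definition cstar_generated :: "'a::unital_cstar_algebra set \<Rightarrow> 'a set" where
  "cstar_generated X = \<Inter>{B. cstar_subalgebra B \<and> X \<subseteq> B}"

definition closed_ideal_of :: "'a::unital_cstar_algebra set \<Rightarrow> 'a set \<Rightarrow> bool" where
  "closed_ideal_of I B \<longleftrightarrow> I \<subseteq> B \<and> complex_subspace I \<and> closed I \<and>
     (\<forall>b\<in>B. \<forall>x\<in>I. b * x \<in> I \<and> x * b \<in> I)"

definition simple_cstar :: "'a::unital_cstar_algebra set \<Rightarrow> bool" where
  "simple_cstar B \<longleftrightarrow> B \<noteq> {0} \<and> (\<forall>I. closed_ideal_of I B \<longrightarrow> I = {0} \<or> I = B)"

text \<open>The positive elements of a C*-algebra are those of the form \<open>adj y * y\<close>.\<close>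

definition conditional_expectation ::
    "'a::unital_cstar_algebra set \<Rightarrow> ('a \<Rightarrow> 'a) \<Rightarrow> bool" where
  "conditional_expectation B E \<longleftrightarrow>
     (\<forall>x. E x \<in> B) \<and> (\<forall>b\<in>B. E b = b) \<and>
     (\<forall>x y. E (x + y) = E x + E y) \<and> (\<forall>c x. E (c *\<^sub>C x) = c *\<^sub>C E x) \<and>
     (\<forall>b\<in>B. \<forall>x. E (b * x) = b * E x \<and> E (x * b) = E x * b) \<and>
     (\<forall>x. \<exists>y\<in>B. E (adj x * x) = adj y * y)"

definition quasi_basis ::
    "('a::unital_cstar_algebra \<Rightarrow> 'a) \<Rightarrow> nat \<Rightarrow> (nat \<Rightarrow> 'a) \<Rightarrow> (nat \<Rightarrow> 'a) \<Rightarrow> bool" where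
  "quasi_basis E m u v \<longleftrightarrow>
     (\<forall>x. x = (\<Sum>i=1..m. u i * E (v i * x)) \<and> x = (\<Sum>i=1..m. E (x * u i) * v i))"

definition finite_watatani_index :: "'a::unital_cstar_algebra set \<Rightarrow> bool" where
  "finite_watatani_index B \<longleftrightarrow>
     (\<exists>E. conditional_expectation B E \<and> (\<exists>m u v. quasi_basis E m u v))"

section \<open>Relative automorphism groups\<close>

definition cstar_aut :: "('a::unital_cstar_algebra \<Rightarrow> 'a) set" where
  "cstar_aut = {\<phi>. bij \<phi> \<and> cstar_hom cstar_of cstar_of \<phi>}"

definition relative_aut :: "'a::unital_cstar_algebra set \<Rightarrow> ('a \<Rightarrow> 'a) set" where
  "relative_aut B = {\<phi> \<in> cstar_aut. \<forall>b\<in>B. \<phi> b = b}"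

lemma cstar_aut_iff:
  "\<phi> \<in> cstar_aut \<longleftrightarrow> bij \<phi> \<and> (\<forall>x y. \<phi> (x + y) = \<phi> x + \<phi> y) \<and> (\<forall>c x. \<phi> (c *\<^sub>C x) = c *\<^sub>C \<phi> x) \<and>
     (\<forall>x y. \<phi> (x * y) = \<phi> x * \<phi> y) \<and> (\<forall>x. \<phi> (adj x) = adj (\<phi> x))"
proof -
  have "\<phi> 1 = 1" if "bij \<phi>" "\<And>x y. \<phi> (x * y) = \<phi> x * \<phi> y"
  proof -
    obtain z where z: "\<phi> z = 1" using \<open>bij \<phi>\<close> by (metis bij_pointE)
    have "\<phi> 1 = \<phi> 1 * \<phi> z" by (simp add: z)
    also have "\<dots> = \<phi> (1 * z)" by (simp only: that(2))
    finally show ?thesis by (simp add: z)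
  qed
  then show ?thesis
    by (auto simp: cstar_aut_def cstar_hom_def ring_hom_def)
qed

section \<open>Cuntz algebras\<close>

definition cuntz_relations :: "'b cstar_structure \<Rightarrow> nat \<Rightarrow> (nat \<Rightarrow> 'b) \<Rightarrow> bool" where
  "cuntz_relations B n T \<longleftrightarrow>
     (\<forall>i\<in>{1..n}. T i \<in> carrier B) \<and>
     (\<forall>i\<in>{1..n}. \<forall>j\<in>{1..n}. cadj B (T i) \<otimes>\<^bsub>B\<^esub> T j = (if i = j then \<one>\<^bsub>B\<^esub> else \<zero>\<^bsub>B\<^esub>)) \<and>
     (\<Oplus>\<^bsub>B\<^esub>k\<in>{1..n}. T k \<otimes>\<^bsub>B\<^esub> cadj B (T k)) = \<one>\<^bsub>B\<^esub>"

text \<open>The whole type \<open>'a\<close>, with generators \<open>S 1, \<dots>, S n\<close>, is the universal unital C*-algebra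
  with these relations. Letting \<open>B\<close> range only over C*-algebras with carrier in \<open>'a\<close> loses
  nothing: \<open>'a\<close> has at least the cardinality of the continuum, and the C*-subalgebra generated
  by \<open>T 1, \<dots>, T n\<close> in an arbitrary unital C*-algebra is separable, hence has at most that
  cardinality and can be transported to \<open>'a\<close>.\<close>

definition cuntz_algebra :: "nat \<Rightarrow> (nat \<Rightarrow> 'a::unital_cstar_algebra) \<Rightarrow> bool" where
  "cuntz_algebra n S \<longleftrightarrow>
     cuntz_relations cstar_of n S \<and>
     cstar_generated (S ` {1..n}) = UNIV \<and>
     (\<forall>(B :: 'a cstar_structure) T. unital_cstar_structure B \<and> cuntz_relations B n T \<longrightarrow>
        (\<exists>!\<phi>. cstar_hom cstar_of B \<phi> \<and> (\<forall>i\<in>{1..n}. \<phi> (S i) = T i)))"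

end

(*  The algebras are B2 = rho(O_n) and B1 = rho(C), where C is the fixed-point algebra of the sign
    change theta of S_1 and rho(x) = sum_i S_i alpha_i(x) S_i* for the automorphism alpha_i swapping
    S_1 and S_i. Conjugating theta by alpha_i gives the sign change of S_i, and these are pairwise
    outer inequivalent. This is what breaks Galois correspondence: theta itself would have to be
    extended to O_n by all these different sign changes at once.

    Let phi fix B1 pointwise. Then D = rho(S_1)* phi(rho(S_1)) commutes with B1, hence is a diagonal
    sum_i d_i S_i S_i* of scalars, and phi(rho(S_1)) = rho(S_1) D. The elements b_ij = S_i* phi(S_j)
    intertwine phi with quasi-free automorphisms whose phases depend on d_i, and d_i different from 1
    would make the rows i and k of the unitary matrix (b_ij) orthogonal in the strong sense
    b_ij b_kl* = 0 for all j, l; as b_kl* b_kl is a scalar, row i would vanish. So D = 1.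

    Every statement on intertwiners and commutants rests on one limit: compressing x by the aperiodic
    words a^m b makes it asymptotically scalar. Simplicity of C is Cuntz's argument, with a lower
    bound for finite averages over the gauge group in place of a faithful conditional expectation.
    No positivity theory is needed: sums x* x + y* y are (S_1 x + S_2 y)* (S_1 x + S_2 y). *)

theory Submission
  imports Defs
begin

section \<open>Elementary C*-algebra\<close>

text \<open>The twist by the \<open>alpha i\<close> is what excludes the obvious extra automorphism.
  For the untwisted map, which sends x to the sum of all \<open>S i * x * adj (S i)\<close>, the
  sign change \<open>theta (- 1)\<close> commutes with the map; it therefore fixes the image of C
  pointwise and moves the image of \<open>S 1\<close>. With the twist, the diagonal entry of index i
  asks for the sign change of \<open>S i\<close> instead. The whole of O_n cannot be paired with C
  directly: its relative automorphism group is trivial, whereas \<open>theta (- 1)\<close> fixes C.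
  This is why both algebras are pushed into a proper copy of O_n. The algebra is accessible only
  through its universal property and its generators, so the analysis is extracted from these.
  Endomorphisms are contractive because a strict contraction is an entry of an isometric column, and
  averages over roots of unity are exact on polynomials of small degree.\<close>

lemma scaleC_one [simp]: "1 *\<^sub>C x = (x :: 'a::unital_cstar_algebra)"
  using scaleR_scaleC[of 1 x] by simp

lemma scaleC_zero_left [simp]: "0 *\<^sub>C x = (0 :: 'a::unital_cstar_algebra)"
  using scaleC_add_left[of 0 0 x] by simp

lemma scaleC_zero_right [simp]: "c *\<^sub>C 0 = (0 :: 'a::unital_cstar_algebra)"
  using scaleC_add_right[of c 0 0] by simp

lemma scaleC_uminus_left: "(- c) *\<^sub>C x = - (c *\<^sub>C (x :: 'a::unital_cstar_algebra))"
  by (metis add.right_inverse add_eq_0_iff scaleC_add_left scaleC_zero_left)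

lemma scaleC_uminus_right: "c *\<^sub>C (- x) = - (c *\<^sub>C (x :: 'a::unital_cstar_algebra))"
  by (metis add.right_inverse add_eq_0_iff scaleC_add_right scaleC_zero_right)

lemma scaleC_diff_right: "c *\<^sub>C (x - y) = c *\<^sub>C x - c *\<^sub>C (y :: 'a::unital_cstar_algebra)"
  using scaleC_add_right[of c x "- y"] by (simp add: scaleC_uminus_right)

lemma scaleC_diff_left: "(c - d) *\<^sub>C x = c *\<^sub>C x - d *\<^sub>C (x :: 'a::unital_cstar_algebra)"
  using scaleC_add_left[of c "- d" x] by (simp add: scaleC_uminus_left)

lemma scaleC_minus_one [simp]: "(- 1) *\<^sub>C x = - (x :: 'a::unital_cstar_algebra)"
  by (simp add: scaleC_uminus_left)

lemma scaleC_sum_right: "c *\<^sub>C (\<Sum>i\<in>I. f i) = (\<Sum>i\<in>I. c *\<^sub>C (f i :: 'a::unital_cstar_algebra))"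
  by (induction I rule: infinite_finite_induct) (simp_all add: scaleC_add_right)

lemma scaleC_sum_left: "(\<Sum>i\<in>I. f i) *\<^sub>C x = (\<Sum>i\<in>I. f i *\<^sub>C (x :: 'a::unital_cstar_algebra))"
  by (induction I rule: infinite_finite_induct) (simp_all add: scaleC_add_left)

lemma scaleC_eq_0_iff [simp]: "c *\<^sub>C x = 0 \<longleftrightarrow> c = 0 \<or> x = (0 :: 'a::unital_cstar_algebra)"
  by (metis mult_eq_0_iff norm_eq_zero norm_scaleC)

lemma adj_zero [simp]: "adj 0 = (0 :: 'a::unital_cstar_algebra)"
  using adj_add[of 0 0] by simp

lemma adj_uminus: "adj (- x) = - adj (x :: 'a::unital_cstar_algebra)"
  by (metis add.right_inverse add_eq_0_iff adj_add adj_zero)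

lemma adj_diff: "adj (x - y) = adj x - adj (y :: 'a::unital_cstar_algebra)"
  using adj_add[of x "- y"] by (simp add: adj_uminus)

lemma adj_one [simp]: "adj 1 = (1 :: 'a::unital_cstar_algebra)"
  by (metis adj_adj adj_mult mult.right_neutral mult.left_neutral)

lemma adj_sum: "adj (\<Sum>i\<in>I. f i) = (\<Sum>i\<in>I. adj (f i :: 'a::unital_cstar_algebra))"
  by (induction I rule: infinite_finite_induct) (simp_all add: adj_add)

lemma norm_adj [simp]: "norm (adj x) = norm (x :: 'a::unital_cstar_algebra)"
proof -
  have le: "norm y \<le> norm (adj y)" for y :: 'a
  proof (cases "y = 0")
    case False
    have "norm y * norm y \<le> norm (adj y) * norm y"
      using cstar_identity[of y] norm_mult_ineq[of "adj y" y] by (simp add: power2_eq_square)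
    then show ?thesis using False by simp
  qed simp
  show ?thesis using le[of x] le[of "adj x"] by (simp add: adj_adj)
qed

lemma adj_mult_self_eq_0_iff: "adj x * x = 0 \<longleftrightarrow> x = (0 :: 'a::unital_cstar_algebra)"
  by (metis cstar_identity mult_zero_right norm_eq_zero power_eq_0_iff zero_neq_numeral)

lemma bounded_linear_adj: "bounded_linear (adj :: 'a::unital_cstar_algebra \<Rightarrow> 'a)"
  by (rule bounded_linear_intro[where K = 1]) (auto simp: adj_add scaleR_scaleC adj_scaleC)

lemma bounded_linear_scaleC: "bounded_linear (\<lambda>x. c *\<^sub>C (x :: 'a::unital_cstar_algebra))"
  by (rule bounded_linear_intro[where K = "cmod c"])
    (auto simp: scaleC_add_right scaleR_scaleC scaleC_scaleC norm_scaleC mult.commute)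

lemmas tendsto_adj = bounded_linear.tendsto[OF bounded_linear_adj]
lemmas tendsto_scaleC = bounded_linear.tendsto[OF bounded_linear_scaleC]

lemma bounded_linear_scaleC_left: "bounded_linear (\<lambda>c. c *\<^sub>C (x :: 'a::unital_cstar_algebra))"
proof -
  have "(r *\<^sub>R c) *\<^sub>C x = r *\<^sub>R (c *\<^sub>C x)" for r :: real and c :: complex
    unfolding scaleR_conv_of_real[of r c] scaleR_scaleC[of r "c *\<^sub>C x"] scaleC_scaleC ..
  then show ?thesis
    by (intro bounded_linear_intro[where K = "norm x"]) (auto simp: scaleC_add_left norm_scaleC)
qed

text \<open>The scalars are an isometric copy of the complete space of complex numbers, because
  \<open>norm 1 = 1\<close>. Closedness is what turns "asymptotically scalar" into "scalar".\<close>

lemma closed_scalars: "closed (range (\<lambda>c. c *\<^sub>C (1 :: 'a::unital_cstar_algebra)))"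
proof -
  have "complete ((\<lambda>c. c *\<^sub>C (1 :: 'a)) ` UNIV)"
    by (rule complete_isometric_image[where e = 1])
      (auto simp: norm_scaleC complete_UNIV bounded_linear_scaleC_left)
  then show ?thesis by (simp add: complete_imp_closed)
qed

text \<open>With \<open>b = 1 - c\<close> the equation becomes \<open>c = (h + c * c) / 2\<close>,
  which Banach's fixed point theorem solves on a closed ball of self-adjoint elements.\<close>

lemma sqrt_one_minus_exists:
  fixes h :: "'a::unital_cstar_algebra"
  assumes "adj h = h" "norm h < 1"
  obtains b where "adj b = b" "b * b = 1 - h"
proof -
  define t where "t = norm h"
  \<comment> \<open>\<open>r\<close> is the smaller root of \<open>r = (t + r * r) / 2\<close>: the
    ball of radius \<open>r\<close> is mapped into itself, and the same \<open>r < 1\<close> is a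
    Lipschitz constant there.\<close>
  define r where "r = 1 - sqrt (1 - t)"
  have t: "0 \<le> t" "t < 1" using assms by (auto simp: t_def)
  have r: "0 \<le> r" "r < 1" using t by (auto simp: r_def)
  have "(1 - r)\<^sup>2 = 1 - t" using t by (simp add: r_def)
  then have rt: "(t + r * r) / 2 = r" by (simp add: power2_eq_square algebra_simps)
  define s where "s = {c :: 'a. norm c \<le> r \<and> adj c = c}"
  define f where "f c = (1/2) *\<^sub>R (h + c * c)" for c
  have adj_scaleR: "adj (q *\<^sub>R x) = q *\<^sub>R adj x" for q and x :: 'a
    by (simp add: scaleR_scaleC adj_scaleC)
  have "closed s"
    unfolding s_def
    by (intro closed_Collect_conj closed_Collect_le closed_Collect_eq continuous_intros
        linear_continuous_on bounded_linear_adj)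
  then have "complete s" by (simp add: complete_eq_closed)
  moreover have "s \<noteq> {}" using r by (auto simp: s_def intro!: exI[of _ 0])
  moreover have "f ` s \<subseteq> s"
  proof (clarsimp simp: s_def f_def assms adj_add adj_mult adj_scaleR)
    fix c :: 'a assume c: "norm c \<le> r" "adj c = c"
    have "norm (h + c * c) \<le> t + r * r"
      unfolding t_def
      by (rule norm_triangle_le[OF add_left_mono[OF order_trans[OF norm_mult_ineq]]])
        (use c r in \<open>auto intro: mult_mono\<close>)
    then show "norm (h + c * c) \<le> r * 2" using rt by simp
  qed
  moreover have "\<forall>x\<in>s. \<forall>y\<in>s. dist (f x) (f y) \<le> r * dist x y"
  proof (intro ballI)
    fix x y assume xy: "x \<in> s" "y \<in> s"
    have "f x - f y = (1/2) *\<^sub>R (x * (x - y) + (x - y) * y)"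
      by (simp add: f_def algebra_simps flip: scaleR_add_right)
    then have "dist (f x) (f y) = norm (x * (x - y) + (x - y) * y) / 2"
      by (simp only: dist_norm norm_scaleR)
    moreover have "norm (x * (x - y) + (x - y) * y) \<le> r * norm (x - y) + norm (x - y) * r"
      by (rule norm_triangle_le[OF add_mono[OF order_trans[OF norm_mult_ineq]
              order_trans[OF norm_mult_ineq]]])
        (use xy in \<open>auto simp: s_def intro: mult_left_mono mult_right_mono\<close>)
    ultimately show "dist (f x) (f y) \<le> r * dist x y"
      by (simp add: dist_norm[of x y] mult.commute[of "norm (x - y)" r])
  qed
  ultimately have "\<exists>!c. c \<in> s \<and> f c = c"
    using Banach_fix[of s r f] r by blast
  then obtain c where c: "c \<in> s" "f c = c" by blast
  have "2 *\<^sub>R c = h + c * c"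
    using c(2) unfolding f_def by (metis scaleR_scaleR scaleR_one divide_self_if mult.commute times_divide_eq_left zero_neq_numeral mult_1)
  then have "(1 - c) * (1 - c) = 1 - h"
    by (simp add: algebra_simps scaleR_2)
  moreover have "adj (1 - c) = 1 - c" using c(1) by (simp add: s_def adj_diff)
  ultimately show thesis using that by blast
qed

section \<open>Unital *-endomorphisms and complex linear spans\<close>

definition star_hom :: "('a::unital_cstar_algebra \<Rightarrow> 'a) \<Rightarrow> bool" where
  "star_hom \<phi> \<longleftrightarrow> cstar_hom cstar_of cstar_of \<phi>"

lemma star_hom_iff:
  "star_hom \<phi> \<longleftrightarrow> (\<forall>x y. \<phi> (x + y) = \<phi> x + \<phi> y) \<and> (\<forall>x y. \<phi> (x * y) = \<phi> x * \<phi> y) \<and>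
    \<phi> 1 = 1 \<and> (\<forall>c x. \<phi> (c *\<^sub>C x) = c *\<^sub>C \<phi> x) \<and> (\<forall>x. \<phi> (adj x) = adj (\<phi> x))"
  by (auto simp: star_hom_def cstar_hom_def ring_hom_def)

context
  fixes \<phi> :: "'a::unital_cstar_algebra \<Rightarrow> 'a"
  assumes hom: "star_hom \<phi>"
begin

lemma star_hom_add: "\<phi> (x + y) = \<phi> x + \<phi> y"
  and star_hom_mult: "\<phi> (x * y) = \<phi> x * \<phi> y"
  and star_hom_one: "\<phi> 1 = 1"
  and star_hom_scaleC: "\<phi> (c *\<^sub>C x) = c *\<^sub>C \<phi> x"
  and star_hom_adj: "\<phi> (adj x) = adj (\<phi> x)"
  using hom by (auto simp: star_hom_iff)

lemma star_hom_zero: "\<phi> 0 = 0"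
  using star_hom_add[of 0 0] by simp

lemma star_hom_uminus: "\<phi> (- x) = - \<phi> x"
  using star_hom_scaleC[of "- 1" x] by simp

lemma star_hom_diff: "\<phi> (x - y) = \<phi> x - \<phi> y"
  using star_hom_add[of x "- y"] by (simp add: star_hom_uminus)

lemma star_hom_sum: "\<phi> (\<Sum>i\<in>I. f i) = (\<Sum>i\<in>I. \<phi> (f i))"
  by (induction I rule: infinite_finite_induct) (simp_all add: star_hom_add star_hom_zero)

lemma star_hom_power: "\<phi> (x ^ k) = \<phi> x ^ k"
  by (induction k) (simp_all add: star_hom_mult star_hom_one)

lemmas star_hom_simps = star_hom_add star_hom_mult star_hom_one star_hom_scaleC star_hom_adj
  star_hom_zero star_hom_uminus star_hom_diff star_hom_sum star_hom_power

end

inductive_set cspan :: "'a::unital_cstar_algebra set \<Rightarrow> 'a set" for X where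
  zero: "0 \<in> cspan X"
| base: "x \<in> X \<Longrightarrow> x \<in> cspan X"
| add: "x \<in> cspan X \<Longrightarrow> y \<in> cspan X \<Longrightarrow> x + y \<in> cspan X"
| scale: "x \<in> cspan X \<Longrightarrow> c *\<^sub>C x \<in> cspan X"

lemma cspan_diff: "x \<in> cspan X \<Longrightarrow> y \<in> cspan X \<Longrightarrow> x - y \<in> cspan X"
  using cspan.add[of x X "- 1 *\<^sub>C y"] cspan.scale[of y X "- 1"] by simp

lemma cspan_image:
  assumes "x \<in> cspan X"
    and "f 0 = 0" "\<And>x y. f (x + y) = f x + f y" "\<And>c x. f (c *\<^sub>C x) = c *\<^sub>C f x"
    and "\<And>x. x \<in> X \<Longrightarrow> f x \<in> cspan Y"
  shows "f x \<in> cspan Y"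
  using assms(1) by induction (auto simp: assms intro: cspan.intros)

section \<open>Words in the generators\<close>

locale cuntz =
  fixes n :: nat and S :: "nat \<Rightarrow> 'a::unital_cstar_algebra"
  assumes n2: "n \<ge> 2" and cuntz: "cuntz_algebra n S"
begin

definition L :: "nat set" where "L = {1..n}"

definition rels :: "(nat \<Rightarrow> 'a) \<Rightarrow> bool" where
  "rels T \<longleftrightarrow> (\<forall>i\<in>L. \<forall>j\<in>L. adj (T i) * T j = (if i = j then 1 else 0)) \<and>
    (\<Sum>k\<in>L. T k * adj (T k)) = 1"

lemma rels_iff: "cuntz_relations cstar_of n T \<longleftrightarrow> rels T"
  by (auto simp: cuntz_relations_def rels_def L_def)

lemma rels_S: "rels S"
  using cuntz by (auto simp: cuntz_algebra_def rels_iff)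

lemma rels_orth: "rels T \<Longrightarrow> i \<in> L \<Longrightarrow> j \<in> L \<Longrightarrow>
    adj (T i) * (T j * x) = (if i = j then x else 0)"
  by (simp add: rels_def flip: mult.assoc)

lemma S_orth: "i \<in> L \<Longrightarrow> j \<in> L \<Longrightarrow> adj (S i) * S j = (if i = j then 1 else 0)"
  using rels_S by (simp add: rels_def)

lemma S_orth': "i \<in> L \<Longrightarrow> j \<in> L \<Longrightarrow> adj (S i) * (S j * x) = (if i = j then x else 0)"
  using rels_S by (rule rels_orth)

lemma S_sum: "(\<Sum>k\<in>L. S k * adj (S k)) = 1"
  using rels_S by (simp add: rels_def)

lemma letters: "1 \<in> L" "Suc 0 \<in> L" "2 \<in> L"
  using n2 by (auto simp: L_def)

lemma S_nonzero: "i \<in> L \<Longrightarrow> S i \<noteq> 0"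
  using S_orth[of i i] by auto

lemma endo_exists:
  assumes "rels T"
  shows "\<exists>\<phi>. star_hom \<phi> \<and> (\<forall>i\<in>L. \<phi> (S i) = T i)"
  using cuntz assms unital_cstar_structure_cstar_of unfolding cuntz_algebra_def rels_iff[symmetric]
    star_hom_def L_def by blast

lemma rels_image:
  assumes "star_hom \<phi>" "rels T" shows "rels (\<lambda>i. \<phi> (T i))"
proof -
  have "adj (\<phi> (T i)) * \<phi> (T j) = \<phi> (adj (T i) * T j)"
    and "(\<Sum>k\<in>L. \<phi> (T k) * adj (\<phi> (T k))) = \<phi> (\<Sum>k\<in>L. T k * adj (T k))" for i j
    using assms(1) by (simp_all add: star_hom_simps)
  then show ?thesis
    using assms(2) by (simp add: rels_def star_hom_one[OF assms(1)] star_hom_zero[OF assms(1)])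
qed

text \<open>The uniqueness half of the universal property, applied to the family of the images of
  the generators.\<close>

lemma star_hom_eqI:
  assumes "star_hom \<phi>" "star_hom \<psi>" "\<And>i. i \<in> L \<Longrightarrow> \<phi> (S i) = \<psi> (S i)"
  shows "\<phi> = \<psi>"
proof -
  have "\<exists>!\<phi>'. cstar_hom cstar_of cstar_of \<phi>' \<and> (\<forall>i\<in>L. \<phi>' (S i) = \<phi> (S i))"
    using cuntz rels_image[OF assms(1) rels_S] unital_cstar_structure_cstar_of
    unfolding cuntz_algebra_def rels_iff[symmetric] L_def by blast
  then show ?thesis
    using assms unfolding star_hom_def by metis
qed

section \<open>Isometries and contractivity of *-endomorphisms\<close>

lemma norm_isometry_mult:
  assumes "adj v * v = 1" shows "norm (v * x) = norm (x :: 'a)"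
proof -
  have "adj (v * x) * (v * x) = adj x * (adj v * v) * x"
    by (simp add: adj_mult mult.assoc)
  then have "(norm (v * x))\<^sup>2 = (norm x)\<^sup>2"
    unfolding cstar_identity[symmetric] by (simp add: assms)
  then show ?thesis by simp
qed

lemma norm_isometry: "adj v * v = 1 \<Longrightarrow> norm (v :: 'a) = 1"
  using norm_isometry_mult[of v 1] by simp

text \<open>A strict contraction \<open>x\<close> is the first entry of an isometric column whose
  second entry \<open>b\<close> is a square root of \<open>1 - adj x * x\<close>. Packing the image
  of the column into \<open>S 1 * \<phi> x + S 2 * \<phi> b\<close> gives one isometry, from which
  \<open>adj (S 1)\<close> recovers \<open>\<phi> x\<close>. Rescaling handles general
  \<open>x\<close>.\<close>

lemma star_hom_norm_le:
  assumes "star_hom \<phi>" shows "norm (\<phi> x) \<le> norm (x :: 'a)"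
proof -
  note hom = star_hom_simps[OF assms]
  have le1: "norm (\<phi> x) \<le> 1" if x: "norm x < 1" for x
  proof -
    have "norm (adj x * x) < 1"
      unfolding cstar_identity using x by (simp add: power_less_one_iff)
    then obtain b where b: "adj b = b" "b * b = 1 - adj x * x"
      using sqrt_one_minus_exists[of "adj x * x"] by (auto simp: adj_mult adj_adj)
    define v where "v = S 1 * \<phi> x + S 2 * \<phi> b"
    have "adj v * v = adj (\<phi> x) * \<phi> x + adj (\<phi> b) * \<phi> b"
      using letters by (simp add: v_def adj_add adj_mult distrib_left distrib_right mult.assoc S_orth')
    also have "\<dots> = \<phi> (adj x * x + b * b)"
      by (simp add: hom b(1) flip: hom(5))
    finally have "norm v = 1"
      by (intro norm_isometry) (simp add: b(2) hom)
    moreover have "\<phi> x = adj (S 1) * v"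
      using letters by (simp add: v_def distrib_left S_orth')
    ultimately show ?thesis
      using norm_mult_ineq[of "adj (S 1)" v] norm_isometry[of "S 1"] letters by (simp add: S_orth)
  qed
  show ?thesis
  proof (rule dense_ge)
    fix r assume r: "norm x < r"
    then have "r > 0" using norm_ge_zero[of x] by linarith
    have "norm (\<phi> (complex_of_real (1 / r) *\<^sub>C x)) \<le> 1"
      using r \<open>r > 0\<close> by (intro le1) (simp add: norm_scaleC norm_divide)
    then show "norm (\<phi> x) \<le> r"
      using \<open>r > 0\<close> by (simp add: hom norm_scaleC norm_divide field_simps)
  qed
qed

lemma star_hom_bounded_linear: "star_hom \<phi> \<Longrightarrow> bounded_linear (\<phi> :: 'a \<Rightarrow> 'a)"
  by (rule bounded_linear_intro[where K = 1])
    (auto simp: star_hom_simps scaleR_scaleC star_hom_norm_le)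

section \<open>Words, homogeneous polynomials and the dense *-subalgebra of polynomials\<close>

primrec W :: "nat list \<Rightarrow> 'a" where
  "W [] = 1"
| "W (i # s) = S i * W s"

definition words :: "nat \<Rightarrow> nat list set" where
  "words k = {s. set s \<subseteq> L \<and> length s = k}"

lemma words_0: "words 0 = {[]}"
  by (auto simp: words_def)

lemma words_Suc: "words (Suc k) = (\<lambda>(i, s). i # s) ` (L \<times> words k)"
  by (force simp: words_def length_Suc_conv)

lemma W_append: "W (s @ t) = W s * W t"
  by (induction s) (simp_all add: mult.assoc)

lemma W_sum: "(\<Sum>s\<in>words k. W s * adj (W s)) = 1"
proof (induction k)
  case (Suc k)
  have "(\<Sum>s\<in>words (Suc k). W s * adj (W s))
      = (\<Sum>i\<in>L. \<Sum>s\<in>words k. S i * (W s * adj (W s)) * adj (S i))"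
    unfolding words_Suc
    by (subst sum.reindex) (auto simp: inj_on_def adj_mult mult.assoc sum.cartesian_product intro!: sum.cong)
  also have "\<dots> = (\<Sum>i\<in>L. S i * (\<Sum>s\<in>words k. W s * adj (W s)) * adj (S i))"
    by (simp add: sum_distrib_left sum_distrib_right)
  finally show ?case by (simp add: Suc S_sum)
qed (simp add: words_0)

lemma W_orth:
  "s \<in> words k \<Longrightarrow> t \<in> words k \<Longrightarrow> adj (W s) * W t = (if s = t then 1 else 0)"
proof (induction k arbitrary: s t)
  case (Suc k)
  then show ?case
    by (auto simp: words_Suc adj_mult mult.assoc S_orth' split: if_splits)
qed (simp add: words_0)

text \<open>Cancellation goes letter by letter: the product survives only if \<open>s\<close> is a
  prefix of \<open>t\<close>, and then the remaining suffix is left.\<close>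

lemma adj_W_mult_W_shorter:
  "s \<in> words k \<Longrightarrow> t \<in> words l \<Longrightarrow> k \<le> l \<Longrightarrow>
    adj (W s) * W t = 0 \<or> (\<exists>r\<in>words (l - k). adj (W s) * W t = W r)"
proof (induction k arbitrary: s t l)
  case (Suc k)
  then obtain l' where l: "l = Suc l'" using Suc_le_D by blast
  then show ?case
    using Suc.prems Suc.IH[of _ _ l'] by (force simp: words_Suc adj_mult mult.assoc S_orth')
qed (auto simp: words_0)

text \<open>A finite-dimensional Hilbert space inside the algebra: \<open>adj u * v\<close> is a
  scalar, the words of length \<open>k\<close> are an orthonormal basis, and the norm of the algebra
  is the Hilbert space norm.\<close>

definition D :: "nat \<Rightarrow> 'a set" where
  "D k = cspan (W ` words k)"

lemma W_in_D: "s \<in> words k \<Longrightarrow> W s \<in> D k"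
  by (auto simp: D_def intro: cspan.base)

lemma D_inner_scalar:
  assumes "u \<in> D k" "v \<in> D k" obtains c where "adj u * v = c *\<^sub>C 1"
proof -
  have 1: "\<exists>c. adj (W s) * v = c *\<^sub>C 1" if "s \<in> words k" for s
    using assms(2) unfolding D_def
  proof induction
    case (base x)
    then show ?case
      using that W_orth[of s k] by (force intro: exI[of _ 0] exI[of _ 1])
  qed (auto simp: distrib_left mult_scaleC_right scaleC_scaleC simp flip: scaleC_add_left intro: exI[of _ 0])
  have "\<exists>c. adj u * v = c *\<^sub>C 1"
    using assms(1) unfolding D_def
    by induction (auto simp: 1 distrib_right mult_scaleC_left scaleC_scaleC adj_add adj_scaleC
        simp flip: scaleC_add_left intro: exI[of _ 0])
  then show thesis using that by blast
qed

lemma W_mult_D: "s \<in> words l \<Longrightarrow> u \<in> D k \<Longrightarrow> W s * u \<in> D (l + k)"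
  unfolding D_def
  by (rule cspan_image) (auto simp: distrib_left mult_scaleC_right words_def simp flip: W_append intro!: cspan.base)

lemma D_mult_W: "s \<in> words l \<Longrightarrow> u \<in> D k \<Longrightarrow> u * W s \<in> D (k + l)"
  unfolding D_def
  by (rule cspan_image[where f = "\<lambda>u. u * W s"]) (auto simp: distrib_right mult_scaleC_left words_def simp flip: W_append intro!: cspan.base)

lemma adj_W_mult_D:
  assumes "s \<in> words l" "u \<in> D k" "l \<le> k" shows "adj (W s) * u \<in> D (k - l)"
  using assms(2) unfolding D_def
proof (rule cspan_image)
  fix x assume "x \<in> W ` words k"
  then show "adj (W s) * x \<in> cspan (W ` words (k - l))"
    using adj_W_mult_W_shorter[OF assms(1) _ assms(3)] by (fastforce intro: cspan.intros)
qed (auto simp: distrib_left mult_scaleC_right)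

text \<open>The polynomials in the generators and their adjoints, in the normal form with all
  adjoints on the right.\<close>

definition P :: "'a set" where
  "P = cspan {W s * adj (W t) | s t. set s \<subseteq> L \<and> set t \<subseteq> L}"

lemma P_base: "s \<in> words k \<Longrightarrow> t \<in> words l \<Longrightarrow> W s * adj (W t) \<in> P"
  by (auto simp: P_def words_def intro: cspan.base)

lemma P_zero: "0 \<in> P"
  and P_add: "x \<in> P \<Longrightarrow> y \<in> P \<Longrightarrow> x + y \<in> P"
  and P_scale: "x \<in> P \<Longrightarrow> c *\<^sub>C x \<in> P"
  by (auto simp: P_def intro: cspan.intros)

lemma P_induct [consumes 1, case_names zero base add scale]:
  assumes "x \<in> P" "Q 0"
    "\<And>s t k l. s \<in> words k \<Longrightarrow> t \<in> words l \<Longrightarrow> Q (W s * adj (W t))"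
    "\<And>x y. x \<in> P \<Longrightarrow> Q x \<Longrightarrow> y \<in> P \<Longrightarrow> Q y \<Longrightarrow> Q (x + y)"
    "\<And>c x. x \<in> P \<Longrightarrow> Q x \<Longrightarrow> Q (c *\<^sub>C x)"
  shows "Q x"
  using assms(1) unfolding P_def
  by induction (use assms in \<open>auto simp: P_def words_def\<close>)

lemma P_mult: assumes "x \<in> P" "y \<in> P" shows "x * y \<in> P"
proof -
  have base: "W s * adj (W t) * (W u * adj (W v)) \<in> P"
    if w: "s \<in> words a" "t \<in> words b" "u \<in> words c" "v \<in> words d" for s t u v a b c d
  proof (cases "b \<le> c")
    case True
    have "W s * adj (W t) * (W u * adj (W v)) = W s * (adj (W t) * W u) * adj (W v)"
      by (simp add: mult.assoc)
    moreover have "W s * W r * adj (W v) \<in> P" if "r \<in> words (c - b)" for r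
      using P_base[of "s @ r" "a + (c - b)" v d] w that by (auto simp: W_append words_def)
    ultimately show ?thesis
      using adj_W_mult_W_shorter[OF w(2,3) True] by (auto simp: P_def cspan.zero)
  next
    case False
    have "W s * adj (W t) * (W u * adj (W v)) = W s * adj (W v * (adj (W u) * W t))"
      by (simp add: mult.assoc adj_mult adj_adj)
    moreover have "W s * adj (W v * W r) \<in> P" if "r \<in> words (b - c)" for r
      using P_base[of s a "v @ r" "d + (b - c)"] w that by (auto simp: W_append words_def)
    ultimately show ?thesis
      using adj_W_mult_W_shorter[OF w(3,2)] False by (auto simp: P_def cspan.zero)
  qed
  have left: "W s * adj (W t) * y \<in> P" if "s \<in> words a" "t \<in> words b" for s t a b
    using assms(2)
    by (induction rule: P_induct)
      (auto simp: base[OF that] distrib_left mult_scaleC_right intro: P_zero P_add P_scale)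
  show ?thesis
    using assms(1)
    by (induction rule: P_induct)
      (auto simp: distrib_right mult_scaleC_left intro: left P_zero P_add P_scale)
qed

lemma P_adj: "x \<in> P \<Longrightarrow> adj x \<in> P"
  by (induction rule: P_induct)
    (auto simp: adj_mult adj_adj P_base adj_add adj_scaleC intro: P_zero P_add P_scale)

text \<open>The closure of \<open>P\<close> is a C*-subalgebra that contains the generators, hence
  it is everything.\<close>

lemma P_dense:
  fixes x :: 'a assumes "e > 0" obtains p where "p \<in> P" "norm (x - p) < e"
proof -
  have "cstar_subalgebra (closure P)"
    unfolding cstar_subalgebra_def complex_subspace_def
  proof (intro conjI ballI allI)
    show "0 \<in> closure P" using P_zero closure_subset by blast
    fix x assume "x \<in> closure P"
    then obtain f where f: "\<And>k. f k \<in> P" "f \<longlonglongrightarrow> x" by (auto simp: closure_sequential)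
    show "adj x \<in> closure P"
      unfolding closure_sequential by (rule exI[of _ "\<lambda>k. adj (f k)"]) (intro conjI allI P_adj tendsto_adj f)
    show "c *\<^sub>C x \<in> closure P" for c
      unfolding closure_sequential by (rule exI[of _ "\<lambda>k. c *\<^sub>C f k"]) (intro conjI allI P_scale tendsto_scaleC f)
    fix y assume "y \<in> closure P"
    then obtain g where g: "\<And>k. g k \<in> P" "g \<longlonglongrightarrow> y" by (auto simp: closure_sequential)
    show "x + y \<in> closure P"
      unfolding closure_sequential by (rule exI[of _ "\<lambda>k. f k + g k"]) (intro conjI allI P_add tendsto_add f g)
    show "x * y \<in> closure P"
      unfolding closure_sequential by (rule exI[of _ "\<lambda>k. f k * g k"]) (intro conjI allI P_mult tendsto_mult f g)
  qed simp
  moreover have "S ` L \<subseteq> closure P"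
  proof -
    have "S i \<in> P" if "i \<in> L" for i
      using P_base[of "[i]" 1 "[]" 0] that by (auto simp: words_def)
    then show ?thesis using closure_subset by blast
  qed
  ultimately have "x \<in> closure P"
    using cuntz unfolding cuntz_algebra_def cstar_generated_def L_def by blast
  then show thesis
    using assms that unfolding closure_approachable by (metis dist_norm norm_minus_commute)
qed

section \<open>Compression by the words \<open>a\<^sup>m b\<close>\<close>

text \<open>The words \<open>a\<^sup>m b\<close> with \<open>a \<noteq> b\<close> are aperiodic: compressing by them asymptotically annihilates
  every \<open>W s * adj (W t)\<close> with \<open>length s \<noteq> length t\<close> and turns the others into scalars.\<close>

definition spike :: "nat \<Rightarrow> nat \<Rightarrow> nat \<Rightarrow> 'a" where
  "spike a b m = S a ^ m * S b"

lemma spike_Suc: "spike a b (Suc m) = S a * spike a b m"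
  by (simp add: spike_def mult.assoc)

text \<open>For \<open>a \<noteq> a'\<close> the words clash in their first letters; both exponents
  must be positive, since otherwise the final letter of one word may equal the first letter of the
  other. For \<open>a = a'\<close> the shorter word reaches its final letter, which is not
  \<open>a\<close>, where the longer one still has \<open>a\<close>.\<close>

lemma spike_orth:
  assumes "a \<in> L" "b \<in> L" "a' \<in> L" "b' \<in> L" "a \<noteq> b" "a' \<noteq> b'"
    and "a \<noteq> a' \<and> k > 0 \<and> l > 0 \<or> a = a' \<and> k \<noteq> l"
  shows "adj (spike a b k) * spike a' b' l = 0"
  using assms(7)
proof (induction k arbitrary: l)
  case 0
  then obtain l' where "l = Suc l'" "a = a'" using not0_implies_Suc by auto
  then show ?case using assms(1-6) by (simp add: spike_Suc) (simp add: spike_def S_orth')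
next
  case (Suc k)
  show ?case
  proof (cases l)
    case 0
    then have "a = a'" using Suc.prems by auto
    then show ?thesis
      using assms(1-6) 0
      by (simp add: spike_Suc adj_mult mult.assoc) (simp add: spike_def S_orth)
  next
    case (Suc l')
    then show ?thesis
      using assms(1-6) Suc.IH[of l'] Suc.prems
      by (auto simp: spike_Suc adj_mult mult.assoc S_orth')
  qed
qed

lemma spike_isometry:
  assumes "a \<in> L" "b \<in> L" shows "adj (spike a b k) * spike a b k = 1"
  by (induction k) (use assms in \<open>simp_all add: spike_Suc adj_mult mult.assoc S_orth' S_orth,
    simp add: spike_def S_orth\<close>)

lemma spike_inner_scalar:
  assumes "a \<in> L" "b \<in> L" "b' \<in> L"
  shows "adj (spike a b k) * spike a b' k = (if b = b' then 1 else 0)"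
  by (induction k) (use assms in \<open>simp_all add: spike_Suc adj_mult mult.assoc S_orth' S_orth,
    simp_all add: spike_def S_orth\<close>)

lemma adj_W_mult_spike:
  assumes "a \<in> L" "s \<in> words k" "k \<le> m"
  shows "adj (W s) * spike a b m = 0 \<or> adj (W s) * spike a b m = spike a b (m - k)"
  using assms(2,3)
proof (induction k arbitrary: s m)
  case (Suc k)
  then obtain m' where m: "m = Suc m'" using Suc_le_D by blast
  obtain i t where s: "s = i # t" "i \<in> L" "t \<in> words k"
    using Suc.prems(1) by (auto simp: words_Suc)
  show ?case
    using Suc.IH[OF s(3), of m'] Suc.prems(2) assms(1) s(2)
    by (auto simp: m s(1) spike_Suc adj_mult mult.assoc S_orth')
qed (simp add: words_0)

text \<open>Cancelling \<open>s\<close> and \<open>t\<close> either gives zero or shortens the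
  exponents to \<open>m - k\<close> and \<open>m - l\<close>, which are still positive. The
  shortened spikes are orthogonal unless \<open>a = a'\<close> and \<open>k = l\<close>.\<close>

lemma spike_compress_word:
  assumes ab: "a \<in> L" "b \<in> L" "a' \<in> L" "b' \<in> L" "a \<noteq> b" "a' \<noteq> b'"
    and st: "s \<in> words k" "t \<in> words l" "k < m" "l < m"
  shows "\<exists>c. adj (spike a b m) * (W s * adj (W t)) * spike a' b' m = c *\<^sub>C 1 \<and> (a \<noteq> a' \<longrightarrow> c = 0)"
proof -
  have eq: "adj (spike a b m) * (W s * adj (W t)) * spike a' b' m
      = adj (adj (W s) * spike a b m) * (adj (W t) * spike a' b' m)"
    by (simp add: adj_mult adj_adj mult.assoc)
  consider "adj (W s) * spike a b m = 0" | "adj (W t) * spike a' b' m = 0"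
    | "adj (W s) * spike a b m = spike a b (m - k)" "adj (W t) * spike a' b' m = spike a' b' (m - l)"
    using adj_W_mult_spike[of a s k m b] adj_W_mult_spike[of a' t l m b'] st ab by auto
  then show ?thesis
  proof cases
    case 3
    show ?thesis
    proof (cases "a = a' \<and> k = l")
      case True
      then show ?thesis
        unfolding eq 3 using spike_inner_scalar[of a b b' "m - k"] ab
        by (auto intro: exI[of _ 0] exI[of _ 1])
    next
      case False
      then have "adj (spike a b (m - k)) * spike a' b' (m - l) = 0"
        using st ab by (intro spike_orth) auto
      then show ?thesis unfolding eq 3 by (auto intro: exI[of _ 0])
    qed
  qed (auto simp: eq intro: exI[of _ 0])
qed

text \<open>For a polynomial the compression is exactly scalar as soon as \<open>m\<close> exceeds
  the lengths of its words. Compression by isometries is contractive, so a polynomial within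
  \<open>e\<close> of \<open>x\<close> suffices.\<close>

lemma spike_compress:
  assumes ab: "a \<in> L" "b \<in> L" "a' \<in> L" "b' \<in> L" "a \<noteq> b" "a' \<noteq> b'" and "e > 0"
  obtains M where "\<And>m. m \<ge> M \<Longrightarrow>
    \<exists>c. norm (adj (spike a b m) * x * spike a' b' m - c *\<^sub>C 1) < e \<and> (a \<noteq> a' \<longrightarrow> c = 0)"
proof -
  obtain p where p: "p \<in> P" "norm (x - p) < e" using P_dense[OF \<open>e > 0\<close>] by blast
  have "\<exists>M. \<forall>m\<ge>M. \<exists>c. adj (spike a b m) * p * spike a' b' m = c *\<^sub>C 1 \<and> (a \<noteq> a' \<longrightarrow> c = 0)"
    using p(1)
  proof (induction rule: P_induct)
    case zero
    show ?case by (auto intro: exI[of _ 0])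
  next
    case (base s t k l)
    then show ?case
      using spike_compress_word[OF ab base] by (intro exI[of _ "Suc (max k l)"]) auto
  next
    case (add x y)
    then obtain M N where MN:
      "\<forall>m\<ge>M. \<exists>c. adj (spike a b m) * x * spike a' b' m = c *\<^sub>C 1 \<and> (a \<noteq> a' \<longrightarrow> c = 0)"
      "\<forall>m\<ge>N. \<exists>c. adj (spike a b m) * y * spike a' b' m = c *\<^sub>C 1 \<and> (a \<noteq> a' \<longrightarrow> c = 0)"
      by blast
    show ?case
    proof (intro exI[of _ "max M N"] allI impI)
      fix m assume "max M N \<le> m"
      then obtain c d where
        "adj (spike a b m) * x * spike a' b' m = c *\<^sub>C 1" "a \<noteq> a' \<longrightarrow> c = 0"
        "adj (spike a b m) * y * spike a' b' m = d *\<^sub>C 1" "a \<noteq> a' \<longrightarrow> d = 0"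
        using MN(1)[rule_format, of m] MN(2)[rule_format, of m] by auto
      then show "\<exists>c. adj (spike a b m) * (x + y) * spike a' b' m = c *\<^sub>C 1 \<and> (a \<noteq> a' \<longrightarrow> c = 0)"
        by (intro exI[of _ "c + d"]) (simp add: distrib_left distrib_right scaleC_add_left)
    qed
  next
    case (scale d x)
    then obtain M where M:
      "\<forall>m\<ge>M. \<exists>c. adj (spike a b m) * x * spike a' b' m = c *\<^sub>C 1 \<and> (a \<noteq> a' \<longrightarrow> c = 0)"
      by blast
    show ?case
    proof (intro exI[of _ M] allI impI)
      fix m assume "M \<le> m"
      then obtain c where
        "adj (spike a b m) * x * spike a' b' m = c *\<^sub>C 1" "a \<noteq> a' \<longrightarrow> c = 0"
        using M[rule_format, of m] by auto
      then show "\<exists>c. adj (spike a b m) * (d *\<^sub>C x) * spike a' b' m = c *\<^sub>C 1 \<and> (a \<noteq> a' \<longrightarrow> c = 0)"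
        by (intro exI[of _ "d * c"]) (simp add: mult_scaleC_left mult_scaleC_right scaleC_scaleC)
    qed
  qed
  then obtain M where M: "\<And>m. m \<ge> M \<Longrightarrow>
      \<exists>c. adj (spike a b m) * p * spike a' b' m = c *\<^sub>C 1 \<and> (a \<noteq> a' \<longrightarrow> c = 0)"
    by blast
  show thesis
  proof (rule that)
    fix m assume "m \<ge> M"
    then obtain c where c: "adj (spike a b m) * p * spike a' b' m = c *\<^sub>C 1" "a \<noteq> a' \<longrightarrow> c = 0"
      using M by blast
    have "adj (spike a b m) * x * spike a' b' m - c *\<^sub>C 1 = adj (spike a b m) * ((x - p) * spike a' b' m)"
      by (simp add: c(1)[symmetric] algebra_simps)
    also have "norm \<dots> \<le> norm (x - p)"
      using norm_mult_ineq[of "adj (spike a b m)" "(x - p) * spike a' b' m"]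
        norm_mult_ineq[of "x - p" "spike a' b' m"]
        norm_isometry[OF spike_isometry[of a b m]] norm_isometry[OF spike_isometry[of a' b' m]] ab
      by simp
    finally show "\<exists>c. norm (adj (spike a b m) * x * spike a' b' m - c *\<^sub>C 1) < e \<and> (a \<noteq> a' \<longrightarrow> c = 0)"
      using p(2) c(2) by (auto intro!: exI[of _ c])
  qed
qed

text \<open>Unimodular factors do not change the distance to the scalars. An element reproduced by
  arbitrarily long compressions is therefore a limit of scalars, and for
  \<open>a \<noteq> a'\<close> its norm is below every positive bound.\<close>

lemma spike_fixed_scalar:
  assumes ab: "a \<in> L" "b \<in> L" "a' \<in> L" "b' \<in> L" "a \<noteq> b" "a' \<noteq> b'"
    and x: "\<And>m. \<exists>m'\<ge>m. \<exists>k. cmod k = 1 \<and> x = k *\<^sub>C (adj (spike a b m') * x * spike a' b' m')"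
  obtains c where "x = c *\<^sub>C 1" "a \<noteq> a' \<Longrightarrow> c = 0"
proof -
  have near: "\<exists>c. norm (x - c *\<^sub>C 1) < e \<and> (a \<noteq> a' \<longrightarrow> c = 0)" if e: "e > 0" for e
  proof -
    obtain M where M: "\<And>m. m \<ge> M \<Longrightarrow>
        \<exists>c. norm (adj (spike a b m) * x * spike a' b' m - c *\<^sub>C 1) < e \<and> (a \<noteq> a' \<longrightarrow> c = 0)"
      using spike_compress[OF ab e] by blast
    obtain m k where mk: "m \<ge> M" "cmod k = 1" "x = k *\<^sub>C (adj (spike a b m) * x * spike a' b' m)"
      using x by blast
    obtain c where c: "norm (adj (spike a b m) * x * spike a' b' m - c *\<^sub>C 1) < e" "a \<noteq> a' \<longrightarrow> c = 0"
      using M mk(1) by blast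
    have "x - (k * c) *\<^sub>C 1 = k *\<^sub>C (adj (spike a b m) * x * spike a' b' m - c *\<^sub>C 1)"
      using mk(3) by (simp add: scaleC_diff_right scaleC_scaleC)
    then have "norm (x - (k * c) *\<^sub>C 1) < e"
      using c(1) mk(2) by (simp only: norm_scaleC)
    then show ?thesis using c(2) by (metis mult_zero_right)
  qed
  show thesis
  proof (cases "a = a'")
    case True
    have "x \<in> closure (range (\<lambda>c. c *\<^sub>C 1))"
      unfolding closure_approachable using near by (auto simp: dist_norm norm_minus_commute)
    then show thesis
      using that True by (auto simp: closure_closed[OF closed_scalars])
  next
    case False
    have "norm x \<le> 0"
      by (rule dense_ge) (use near False in force)
    then show thesis using that[of 0] by simp
  qed
qed

end

lemma star_hom_compose: "star_hom \<phi> \<Longrightarrow> star_hom \<psi> \<Longrightarrow> star_hom (\<lambda>x. \<phi> (\<psi> x))"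
  by (simp add: star_hom_iff)

lemma star_hom_id: "star_hom (\<lambda>x. x)"
  by (simp add: star_hom_iff)

text \<open>The constant \<open>N\<close> disappears on taking roots of order \<open>2 ^ j\<close>.
  Powers of two occur because the C*-identity doubles exponents of self-adjoint elements.\<close>

lemma le_if_dyadic_powers_le:
  fixes p d N :: real
  assumes "\<And>j. p ^ 2 ^ j \<le> N * d ^ 2 ^ j" "0 \<le> p" "0 \<le> d" shows "p \<le> d"
proof (rule ccontr)
  assume "\<not> p \<le> d"
  then have pd: "d < p" "p > 0" using assms(3) by auto
  show False
  proof (cases "d = 0")
    case True
    then show False using assms(1)[of 0] pd by simp
  next
    case False
    then have d: "d > 0" using assms(3) by simp
    then have "1 < p / d" using pd by simp
    then obtain k where k: "N < (p / d) ^ k" using real_arch_pow by blast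
    have "(p / d) ^ k \<le> (p / d) ^ 2 ^ k"
      using \<open>1 < p / d\<close> less_exp[of k] by (intro power_increasing) auto
    also have "\<dots> \<le> N" using assms(1)[of k] d by (simp add: power_divide divide_simps mult.commute)
    finally show False using k by simp
  qed
qed

context cuntz
begin

section \<open>Quasi-free automorphisms\<close>

definition endo :: "(nat \<Rightarrow> 'a) \<Rightarrow> 'a \<Rightarrow> 'a" where
  "endo T = (SOME \<phi>. star_hom \<phi> \<and> (\<forall>i\<in>L. \<phi> (S i) = T i))"

lemma endo: assumes "rels T" shows "star_hom (endo T)" "i \<in> L \<Longrightarrow> endo T (S i) = T i"
  using someI_ex[OF endo_exists[OF assms]] by (auto simp: endo_def)

text \<open>Unitary monomial matrices act on the generators; the gauge action, the sign change and
  the swaps of two generators are all of this form.\<close>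

lemma rels_monomial:
  assumes "bij_betw \<pi> L L" "\<And>i. i \<in> L \<Longrightarrow> cmod (c i) = 1"
  shows "rels (\<lambda>i. c i *\<^sub>C S (\<pi> i))"
proof -
  have c: "cnj (c i) * c i = 1" "c i * cnj (c i) = 1" if "i \<in> L" for i
    using assms(2)[OF that] by (simp_all add: complex_norm_square[symmetric] mult.commute)
  have \<pi>: "\<pi> i \<in> L" if "i \<in> L" for i
    using assms(1) that by (auto simp: bij_betw_def)
  have inj: "\<pi> i = \<pi> j \<longleftrightarrow> i = j" if "i \<in> L" "j \<in> L" for i j
    using assms(1) that by (auto simp: bij_betw_def inj_on_def)
  have "(\<Sum>k\<in>L. S (\<pi> k) * adj (S (\<pi> k))) = 1"
    using S_sum sum.reindex_bij_betw[OF assms(1), of "\<lambda>k. S k * adj (S k)"] by simp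
  then show ?thesis
    by (auto simp: rels_def adj_scaleC mult_scaleC_left mult_scaleC_right scaleC_scaleC c \<pi> S_orth inj)
qed

definition gauge :: "complex \<Rightarrow> 'a \<Rightarrow> 'a" where
  "gauge z = endo (\<lambda>i. z *\<^sub>C S i)"

text \<open>The case \<open>s = - 1\<close> is the sign change and \<open>s = 1\<close> is the
  identity, so that the fixed-point algebra and the whole algebra are covered by one simplicity
  argument.\<close>

definition theta :: "complex \<Rightarrow> 'a \<Rightarrow> 'a" where
  "theta s = endo (\<lambda>i. (if i = 1 then s else 1) *\<^sub>C S i)"

lemma gauge_hom: "cmod z = 1 \<Longrightarrow> star_hom (gauge z)"
  and gauge_S: "cmod z = 1 \<Longrightarrow> i \<in> L \<Longrightarrow> gauge z (S i) = z *\<^sub>C S i"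
  unfolding gauge_def using endo[OF rels_monomial[of "\<lambda>i. i" "\<lambda>i. z"]] by (auto simp: bij_betw_def)

lemma theta_hom: "cmod s = 1 \<Longrightarrow> star_hom (theta s)"
  and theta_S: "cmod s = 1 \<Longrightarrow> i \<in> L \<Longrightarrow> theta s (S i) = (if i = 1 then s else 1) *\<^sub>C S i"
  unfolding theta_def using endo[OF rels_monomial[of "\<lambda>i. i" "\<lambda>i. if i = 1 then s else 1"]]
  by (auto simp: bij_betw_def)

lemma gauge_W:
  assumes "cmod z = 1" "s \<in> words k" shows "gauge z (W s) = z ^ k *\<^sub>C W s"
  using assms(2)
proof (induction k arbitrary: s)
  case (Suc k)
  then show ?case
    by (auto simp: words_Suc star_hom_simps[OF gauge_hom[OF assms(1)]] gauge_S assms(1)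
        mult_scaleC_left mult_scaleC_right scaleC_scaleC mult.commute)
qed (simp add: words_0 star_hom_one[OF gauge_hom[OF assms(1)]])

lemma gauge_P_base:
  assumes "cmod z = 1" "s \<in> words k" "t \<in> words l"
  shows "gauge z (W s * adj (W t)) = (z ^ k * cnj z ^ l) *\<^sub>C (W s * adj (W t))"
  using assms by (simp add: star_hom_simps[OF gauge_hom] gauge_W adj_scaleC mult_scaleC_left
      mult_scaleC_right scaleC_scaleC mult.commute)

lemma theta_W:
  assumes "cmod s = 1" "t \<in> words k" obtains c where "theta s (W t) = c *\<^sub>C W t"
proof -
  have "\<exists>c. theta s (W t) = c *\<^sub>C W t"
    using assms(2)
  proof (induction k arbitrary: t)
    case (Suc k)
    then obtain i r where t: "t = i # r" "i \<in> L" "r \<in> words k" by (auto simp: words_Suc)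
    then obtain c where "theta s (W r) = c *\<^sub>C W r" using Suc.IH by blast
    then show ?case
      by (intro exI[of _ "c * (if i = 1 then s else 1)"])
        (simp add: t star_hom_simps[OF theta_hom[OF assms(1)]] theta_S assms(1)
        mult_scaleC_left mult_scaleC_right scaleC_scaleC)
  qed (auto simp: words_0 star_hom_one[OF theta_hom[OF assms(1)]] intro: exI[of _ 1])
  then show thesis using that by blast
qed

lemma theta_D: assumes "cmod s = 1" "u \<in> D k" shows "theta s u \<in> D k"
  using assms(2) unfolding D_def
proof (rule cspan_image)
  fix x assume x: "x \<in> W ` words k"
  then obtain t where t: "t \<in> words k" "x = W t" by blast
  obtain c where "theta s (W t) = c *\<^sub>C W t" using theta_W[OF assms(1) t(1)] .
  then show "theta s x \<in> cspan (W ` words k)"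
    using x t(2) by (auto intro: cspan.scale cspan.base)
qed (auto simp: star_hom_simps[OF theta_hom[OF assms(1)]])

lemma theta_P: assumes "cmod s = 1" shows "p \<in> P \<Longrightarrow> theta s p \<in> P"
proof (induction rule: P_induct)
  case (base a b k l)
  obtain c d where "theta s (W a) = c *\<^sub>C W a" "theta s (W b) = d *\<^sub>C W b"
    using theta_W[OF assms] base by metis
  then show ?case
    using base by (auto simp: star_hom_simps[OF theta_hom[OF assms]] adj_scaleC mult_scaleC_left
        mult_scaleC_right intro!: P_scale P_base)
qed (auto simp: star_hom_simps[OF theta_hom[OF assms]] intro: P_zero P_add P_scale)

lemma theta_gauge:
  assumes "cmod s = 1" "cmod z = 1" shows "theta s (gauge z x) = gauge z (theta s x)"
proof -
  have "(\<lambda>x. theta s (gauge z x)) = (\<lambda>x. gauge z (theta s x))"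
    by (rule star_hom_eqI)
      (simp_all add: assms star_hom_compose theta_hom gauge_hom star_hom_scaleC[OF theta_hom]
        star_hom_scaleC[OF gauge_hom] gauge_S theta_S scaleC_scaleC mult.commute)
  then show ?thesis by metis
qed

lemma theta_one: "theta 1 x = x"
proof -
  have "theta 1 = (\<lambda>x. x)"
    by (rule star_hom_eqI) (simp_all add: theta_hom star_hom_id theta_S)
  then show ?thesis by simp
qed

lemma theta_theta:
  assumes "s = 1 \<or> s = - 1" shows "theta s (theta s x) = x"
proof -
  have s: "cmod s = 1" "s * s = 1" using assms by auto
  have "(\<lambda>x. theta s (theta s x)) = (\<lambda>x. x)"
    by (rule star_hom_eqI)
      (simp_all add: s star_hom_compose theta_hom star_hom_id theta_S star_hom_scaleC[OF theta_hom] scaleC_scaleC)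
  then show ?thesis by metis
qed

section \<open>Averages over the gauge action\<close>

text \<open>On a monomial the gauge action multiplies by a continuous function of \<open>z\<close>.
  Contractivity carries this over from an approximating polynomial to \<open>x\<close>, with a third
  of \<open>e\<close> for each of the three differences.\<close>

lemma gauge_continuous:
  assumes "e > 0"
  obtains d where "d > 0" "\<And>z. cmod z = 1 \<Longrightarrow> cmod (z - 1) < d \<Longrightarrow> norm (gauge z x - x) < e"
proof -
  obtain p where p: "p \<in> P" "norm (x - p) < e / 3" using P_dense[of "e / 3" x] assms by auto
  let ?F = "at 1 within {z. cmod z = 1}"
  have "((\<lambda>z. gauge z p) \<longlongrightarrow> p) ?F"
    using p(1)
  proof (induction rule: P_induct)
    case zero
    show ?case
      by (rule tendsto_eventually) (auto simp: eventually_at_filter star_hom_zero[OF gauge_hom])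
  next
    case (base s t k l)
    have "((\<lambda>z. (z ^ k * cnj z ^ l) *\<^sub>C (W s * adj (W t))) \<longlongrightarrow> (1 ^ k * cnj 1 ^ l) *\<^sub>C (W s * adj (W t))) ?F"
      by (intro bounded_linear.tendsto[OF bounded_linear_scaleC_left] tendsto_intros)
    then have "((\<lambda>z. gauge z (W s * adj (W t))) \<longlongrightarrow> (1 ^ k * cnj 1 ^ l) *\<^sub>C (W s * adj (W t))) ?F"
      by (rule Lim_transform_eventually) (auto simp: eventually_at_filter gauge_P_base[OF _ base])
    then show ?case by simp
  next
    case (add x y)
    show ?case
      by (rule Lim_transform_eventually[OF tendsto_add[OF add.IH]])
        (auto simp: eventually_at_filter star_hom_add[OF gauge_hom])
  next
    case (scale c x)
    show ?case
      by (rule Lim_transform_eventually[OF tendsto_scaleC[OF scale.IH]])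
        (auto simp: eventually_at_filter star_hom_scaleC[OF gauge_hom])
  qed
  from Lim_within[THEN iffD1, OF this, rule_format, of "e / 3"] assms
  obtain d where d: "d > 0"
    "\<And>z. cmod z = 1 \<Longrightarrow> z \<noteq> 1 \<Longrightarrow> dist z 1 < d \<Longrightarrow> dist (gauge z p) p < e / 3"
    by auto
  have "gauge 1 = (\<lambda>x. x)"
    by (rule star_hom_eqI) (simp_all add: gauge_hom star_hom_id gauge_S)
  then have g1: "gauge 1 x = x" by simp
  show thesis
  proof (rule that[OF d(1)])
    fix z assume z: "cmod z = 1" "cmod (z - 1) < d"
    show "norm (gauge z x - x) < e"
    proof (cases "z = 1")
      case False
      have "gauge z x - x = gauge z (x - p) + (gauge z p - p) + (p - x)"
        by (simp add: star_hom_diff[OF gauge_hom[OF z(1)]])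
      also have "norm \<dots> \<le> norm (gauge z (x - p)) + norm (gauge z p - p) + norm (p - x)"
        by (meson add_mono norm_triangle_ineq order_refl order_trans)
      also have "\<dots> < e"
        using d(2)[OF z(1) False] z(2) p(2) star_hom_norm_le[OF gauge_hom[OF z(1)], of "x - p"]
        by (simp add: dist_norm norm_minus_commute)
      finally show ?thesis .
    qed (use assms g1 in simp)
  qed
qed

text \<open>A sequence of isometries with orthogonal ranges. It stores a finite family
  \<open>y j\<close> in the single element given by the sum of the \<open>V j * y j\<close>, and its
  members of even index are invariant under the sign change.\<close>

definition V :: "nat \<Rightarrow> 'a" where "V = spike 1 2"

lemma V_orth: "adj (V i) * V j = (if i = j then 1 else 0)"
  using spike_orth[of 1 2 1 2 i j] spike_isometry[of 1 2 i] letters by (auto simp: V_def)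

lemma V_orth': "adj (V i) * (V j * x) = (if i = j then x else 0)"
  using V_orth[of i j] by (simp flip: mult.assoc)

lemma V_sum_inner:
  assumes "finite J"
  shows "adj (\<Sum>j\<in>J. V j * y j) * (\<Sum>j\<in>J. V j * y j) = (\<Sum>j\<in>J. adj (y j) * y j)"
  using assms
  by (simp add: adj_sum sum_distrib_left sum_distrib_right adj_mult mult.assoc V_orth' if_distrib
      sum.delta cong: if_cong)

lemma V_sum_norm:
  "finite J \<Longrightarrow> (norm (\<Sum>j\<in>J. V j * y j))\<^sup>2 = norm (\<Sum>j\<in>J. adj (y j) * y j)"
  by (simp add: V_sum_inner flip: cstar_identity)

text \<open>The projection \<open>Q\<close> onto the ranges of the \<open>V j\<close> with
  \<open>j \<in> J\<close> maps the longer sum to the shorter one. In effect, dropping positive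
  summands does not increase a norm.\<close>

lemma V_sum_mono:
  assumes "finite K" "J \<subseteq> K"
  shows "norm (\<Sum>j\<in>J. V j * y j) \<le> norm (\<Sum>j\<in>K. V j * y j)"
proof -
  have fin: "finite J" using assms finite_subset by blast
  define Q where "Q = (\<Sum>j\<in>J. V j * adj (V j))"
  have "Q * (\<Sum>j\<in>K. V j * y j) = (\<Sum>j\<in>K. if j \<in> J then V j * y j else 0)"
    using fin by (simp add: Q_def sum_distrib_left sum_distrib_right mult.assoc V_orth' if_distrib sum.delta cong: if_cong)
  also have "\<dots> = (\<Sum>j\<in>J. V j * y j)"
    using assms by (simp add: sum.inter_restrict[symmetric] Int_absorb1)
  finally have eq: "Q * (\<Sum>j\<in>K. V j * y j) = (\<Sum>j\<in>J. V j * y j)" .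
  have "adj Q = Q" by (simp add: Q_def adj_sum adj_mult adj_adj)
  moreover have "Q * Q = Q"
    using fin by (simp add: Q_def sum_distrib_left sum_distrib_right mult.assoc V_orth' if_distrib sum.delta cong: if_cong)
  ultimately have "(norm Q)\<^sup>2 = norm Q" by (metis cstar_identity)
  then have "norm Q \<le> 1" by (auto simp: power2_eq_square)
  then show ?thesis
    using norm_mult_ineq[of Q "\<Sum>j\<in>K. V j * y j"] eq
    by (smt (verit) mult_left_le_one_le norm_ge_zero)
qed

text \<open>A finite substitute for the integral over the circle: on polynomials with words shorter
  than \<open>M\<close> it is exactly the projection onto degree zero.\<close>

definition avg :: "nat \<Rightarrow> 'a \<Rightarrow> 'a" where
  "avg M x = (1 / of_nat M) *\<^sub>C (\<Sum>j<M. gauge (cis (2 * pi / M) ^ j) x)"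

lemma cmod_cis_power: "cmod (cis t ^ j) = 1"
  by (simp add: norm_power)

lemma avg_linear: "avg M (x + y) = avg M x + avg M y" "avg M (c *\<^sub>C x) = c *\<^sub>C avg M x" "avg M 0 = 0"
    "avg M (x - y) = avg M x - avg M y"
  by (simp_all add: avg_def star_hom_simps[OF gauge_hom[OF cmod_cis_power]] sum.distrib sum_subtractf
      scaleC_add_right scaleC_diff_right scaleC_scaleC mult.commute flip: scaleC_sum_right)

lemma avg_norm_le: assumes "M > 0" shows "norm (avg M x) \<le> norm x"
proof -
  have "norm (\<Sum>j<M. gauge (cis (2 * pi / M) ^ j) x) \<le> of_nat (card {..<M}) * norm x"
    by (rule sum_norm_bound) (rule star_hom_norm_le[OF gauge_hom[OF cmod_cis_power]])
  then show ?thesis using assms by (simp add: avg_def norm_scaleC norm_divide field_simps)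
qed

lemma theta_avg: "cmod s = 1 \<Longrightarrow> theta s (avg M x) = avg M (theta s x)"
  by (simp add: avg_def star_hom_simps[OF theta_hom] theta_gauge cmod_cis_power)

text \<open>The monomial is multiplied by the powers of \<open>r\<close>, an \<open>M\<close>-th
  root of unity. For \<open>k \<noteq> l\<close> it differs from 1 because both lengths are below
  \<open>M\<close>, and the geometric sum vanishes.\<close>

lemma avg_P_base:
  assumes "s \<in> words k" "t \<in> words l" "k < M" "l < M"
  shows "avg M (W s * adj (W t)) = (if k = l then W s * adj (W t) else 0)"
proof -
  define z where "z = cis (2 * pi / M)"
  have z: "cmod z = 1" "z * cnj z = 1" "cnj z * z = 1" by (auto simp: z_def cis_cnj cis_mult)
  define r where "r = z ^ k * cnj z ^ l"
  have "gauge (z ^ j) (W s * adj (W t)) = r ^ j *\<^sub>C (W s * adj (W t))" for j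
    using gauge_P_base[OF _ assms(1,2), of "z ^ j"] z
    by (simp add: norm_power r_def power_mult_distrib mult.commute flip: power_mult)
  then have avg: "avg M (W s * adj (W t)) = ((1 / of_nat M) * (\<Sum>j<M. r ^ j)) *\<^sub>C (W s * adj (W t))"
    by (simp add: avg_def z_def[symmetric] scaleC_scaleC flip: scaleC_sum_left)
  show ?thesis
  proof (cases "k = l")
    case True
    then have "r = 1" using z by (simp add: r_def flip: power_mult_distrib)
    then show ?thesis using True avg assms by simp
  next
    case False
    have zp: "z ^ j = exp (2 * of_real pi * \<i> * of_nat j / of_nat M)" for j
      by (simp add: z_def cis_conv_exp mult_ac flip: exp_of_nat_mult)
    have "z ^ k \<noteq> z ^ l"
      unfolding zp using complex_root_unity_eq[of M k l] assms False by simp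
    moreover have "z ^ k = r * z ^ l" using z by (simp add: r_def mult.assoc flip: power_mult_distrib)
    ultimately have "r \<noteq> 1" by auto
    moreover have "r ^ M = 1"
    proof -
      have "z ^ M = 1" unfolding zp using assms by (simp add: exp_two_pi_i)
      then show ?thesis
        by (metis complex_cnj_one complex_cnj_power mult_1 power_commutes power_mult power_mult_distrib power_one r_def mult.commute)
    qed
    ultimately have "(\<Sum>j<M. r ^ j) = 0" by (simp add: geometric_sum)
    then show ?thesis using avg False by simp
  qed
qed

text \<open>A positive proportion of the conjugates \<open>gauge z x\<close> in the average is close to \<open>x\<close>;
  orthogonality of the \<open>V j\<close> keeps the remaining ones from cancelling them.\<close>

lemma avg_lower_bound:
  assumes "x \<noteq> 0"
  obtains d where "d > 0" "\<And>M. M > 0 \<Longrightarrow> norm (avg M (adj x * x)) \<ge> d"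
proof -
  obtain e where e: "e > 0" "\<And>z. cmod z = 1 \<Longrightarrow> cmod (z - 1) < e \<Longrightarrow> norm (gauge z x - x) < norm x / 2"
    using gauge_continuous[of "norm x / 2" x] assms by auto
  have "isCont (\<lambda>t. cis t) 0" unfolding cis_conv_exp by (intro continuous_intros)
  then obtain b where b: "b > 0" "\<And>t. \<bar>t\<bar> < b \<Longrightarrow> cmod (cis t - 1) < e"
    using e(1) unfolding continuous_at_eps_delta by (force simp: dist_norm)
  \<comment> \<open>Rotations by angles below \<open>b\<close> move \<open>x\<close> by less than
    half its norm. They make up at least the proportion \<open>c\<close> of all rotations in the
    average, whatever \<open>M\<close> is.\<close>
  define c where "c = min 1 (b / (2 * pi))"
  have c: "c > 0" "c \<le> 1" "2 * pi * c \<le> b" using b by (auto simp: c_def min_def field_simps)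
  show thesis
  proof (rule that)
    show "c * (norm x)\<^sup>2 / 4 > 0" using c assms by simp
    fix M :: nat assume M: "M > 0"
    define y where "y j = gauge (cis (2 * pi / M) ^ j) x" for j
    define N where "N = nat \<lceil>c * M\<rceil>"
    have N: "real N \<ge> c * M" "N \<le> M" "\<And>j. j < N \<Longrightarrow> real j < c * M"
    proof -
      show "real N \<ge> c * M" unfolding N_def by (rule real_nat_ceiling_ge)
      have "c * M \<le> M" using c M by (simp add: mult_left_le_one_le)
      then show "N \<le> M" by (simp add: N_def ceiling_le_iff nat_le_iff)
      show "real j < c * M" if "j < N" for j
        using that unfolding N_def by linarith
    qed
    have close: "norm (y j - x) \<le> norm x / 2" if "j < N" for j
    proof -
      have "2 * pi / M * j < 2 * pi * c"
        using N(3)[OF that] M by (simp add: field_simps)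
      then have "\<bar>j * (2 * pi / M)\<bar> < b" using c(3) M by (simp add: abs_mult mult.commute)
      then have "cmod (cis (2 * pi / M) ^ j - 1) < e" unfolding Complex.DeMoivre by (rule b(2))
      then show ?thesis using e(2)[OF cmod_cis_power] by (auto simp: y_def less_imp_le)
    qed
    \<comment> \<open>\<open>X f\<close> is the norm of the column with entries \<open>f j\<close>.
      The constant column \<open>x\<close> has norm \<open>sqrt N * norm x\<close>, and the column
      \<open>y\<close> differs from it by at most half of that.\<close>
    define X where "X f = norm (\<Sum>j<N. V j * f j)" for f
    have "(X (\<lambda>j. x))\<^sup>2 = N * (norm x)\<^sup>2"
      by (simp add: X_def V_sum_norm sum_constant_scaleR cstar_identity del: sum_constant)
    then have X1: "X (\<lambda>j. x) = sqrt N * norm x"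
      by (metis X_def norm_ge_zero real_sqrt_mult real_sqrt_unique real_sqrt_abs abs_norm_cancel)
    have "(X (\<lambda>j. y j - x))\<^sup>2 \<le> (\<Sum>j<N. (norm x / 2)\<^sup>2)"
      unfolding X_def V_sum_norm[OF finite_lessThan]
      by (rule sum_norm_le) (use close in \<open>auto simp: cstar_identity intro: power_mono\<close>)
    also have "\<dots> = (sqrt N * norm x / 2)\<^sup>2" by (simp add: power_mult_distrib power_divide)
    finally have X2: "X (\<lambda>j. y j - x) \<le> sqrt N * norm x / 2"
      by (rule power2_le_imp_le) simp
    have "X (\<lambda>j. x) \<le> X y + X (\<lambda>j. y j - x)"
    proof -
      have "(\<Sum>j<N. V j * x) = (\<Sum>j<N. V j * y j) - (\<Sum>j<N. V j * (y j - x))"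
        by (simp add: right_diff_distrib sum_subtractf)
      then show ?thesis unfolding X_def by (metis norm_triangle_ineq4)
    qed
    then have "X y \<ge> sqrt N * norm x / 2" using X1 X2 by simp
    moreover have "X y \<le> norm (\<Sum>j<M. V j * y j)"
      unfolding X_def using N(2) by (intro V_sum_mono) auto
    ultimately have "(sqrt N * norm x / 2)\<^sup>2 \<le> (norm (\<Sum>j<M. V j * y j))\<^sup>2"
      by (intro power_mono) auto
    also have "\<dots> = norm (\<Sum>j<M. adj (y j) * y j)" by (simp add: V_sum_norm)
    also have "\<dots> = M * norm (avg M (adj x * x))"
      using M by (simp add: avg_def y_def star_hom_simps[OF gauge_hom[OF cmod_cis_power]] norm_scaleC norm_divide)
    finally have "N * (norm x)\<^sup>2 / 4 \<le> M * norm (avg M (adj x * x))"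
      by (simp add: power_mult_distrib power_divide)
    moreover have "c * M * (norm x)\<^sup>2 / 4 \<le> N * (norm x)\<^sup>2 / 4"
      using N(1) by (intro divide_right_mono mult_right_mono) auto
    ultimately have "M * (c * (norm x)\<^sup>2 / 4) \<le> M * norm (avg M (adj x * x))" by (simp add: mult_ac)
    then show "c * (norm x)\<^sup>2 / 4 \<le> norm (avg M (adj x * x))" using M by simp
  qed
qed

section \<open>Degree-zero parts of polynomials and their matrix coefficients\<close>

lemma D_zero: "0 \<in> D k"
  and D_add: "u \<in> D k \<Longrightarrow> v \<in> D k \<Longrightarrow> u + v \<in> D k"
  and D_diff: "u \<in> D k \<Longrightarrow> v \<in> D k \<Longrightarrow> u - v \<in> D k"
  and D_scale: "u \<in> D k \<Longrightarrow> c *\<^sub>C u \<in> D k"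
  unfolding D_def by (auto intro: cspan.intros cspan_diff)

text \<open>Cancelling a positive number of letters changes the index of \<open>V m\<close>, and
  isometries of different index have orthogonal ranges.\<close>

lemma V_compress_word:
  assumes "s \<in> words d" "0 < d" "d \<le> m"
  shows "adj (V m) * W s * V m = 0" "adj (V m) * adj (W s) * V m = 0"
proof -
  have "adj (W s) * V m = 0 \<or> adj (W s) * V m = V (m - d)"
    unfolding V_def using adj_W_mult_spike letters assms by blast
  moreover have "adj (V m) * V (m - d) = 0" using assms by (simp add: V_orth)
  ultimately show 2: "adj (V m) * adj (W s) * V m = 0" by (auto simp: mult.assoc)
  have "adj (V m) * W s * V m = adj (adj (V m) * adj (W s) * V m)"
    by (simp add: adj_mult adj_adj mult.assoc)
  then show "adj (V m) * W s * V m = 0" using 2 by simp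
qed

lemma V_compress_D:
  assumes "u \<in> D i" "w \<in> D j" "i \<noteq> j" "i \<le> m" "j \<le> m"
  shows "adj (V m) * (adj u * w) * V m = 0"
proof -
  have base: "adj (V m) * (adj (W s) * W t) * V m = 0" if st: "s \<in> words i" "t \<in> words j" for s t
  proof (cases "i < j")
    case True
    then show ?thesis
      using adj_W_mult_W_shorter[OF st] V_compress_word(1)[of _ "j - i" m] assms by fastforce
  next
    case False
    have "adj (W s) * W t = adj (adj (W t) * W s)" by (simp add: adj_mult adj_adj)
    then show ?thesis
      using adj_W_mult_W_shorter[OF st(2,1)] V_compress_word(2)[of _ "i - j" m] assms False by fastforce
  qed
  have left: "adj (V m) * (adj (W s) * w) * V m = 0" if "s \<in> words i" for s
    using assms(2) unfolding D_def
    by induction (use base[OF that] in \<open>auto simp: distrib_left distrib_right mult_scaleC_left mult_scaleC_right\<close>)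
  show ?thesis
    using assms(1) unfolding D_def
    by induction (use left in \<open>auto simp: distrib_left distrib_right mult_scaleC_left mult_scaleC_right
        adj_add adj_scaleC\<close>)
qed

text \<open>\<open>p0\<close> is the gauge-invariant part of \<open>p\<close>, recorded by its three
  later uses: as the value of averages, as a matrix acting on the Hilbert space \<open>D k\<close>,
  and as what compression by \<open>V m\<close> retains of \<open>p\<close>. The level
  \<open>k\<close> has to be large relative to the words in \<open>p\<close>.\<close>

definition zero_part :: "'a \<Rightarrow> 'a \<Rightarrow> nat \<Rightarrow> bool" where
  "zero_part p p0 k \<longleftrightarrow> (\<forall>M>k. avg M p = p0) \<and>
    (\<forall>y\<in>D k. p0 * y \<in> D k) \<and> (\<forall>y\<in>D k. adj p0 * y \<in> D k) \<and>
    (\<forall>u\<in>D k. \<forall>w\<in>D k. \<forall>m\<ge>k.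
      adj (V m) * (adj u * p * w) * V m = adj (V m) * (adj u * p0 * w) * V m)"

text \<open>A monomial is its own degree-zero part if its two words have equal length; otherwise
  this part is zero, because the two factors send \<open>D k\<close> to different degrees, which
  compression by \<open>V m\<close> separates.\<close>

lemma zero_part_exists:
  assumes "p \<in> P" shows "\<exists>p0 K. \<forall>k\<ge>K. zero_part p p0 k"
  using assms
proof (induction rule: P_induct)
  case zero
  have "zero_part 0 0 k" for k by (simp add: zero_part_def avg_linear D_zero)
  then show ?case by blast
next
  case (base s t a b)
  show ?case
  proof (cases "a = b")
    case True
    have D: "W s' * adj (W t') * y \<in> D k" if "s' \<in> words a" "t' \<in> words a" "a \<le> k" "y \<in> D k" for s' t' k y
      using W_mult_D[OF that(1) adj_W_mult_D[OF that(2,4,3)]] that(3) by (simp add: mult.assoc)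
    have "zero_part (W s * adj (W t)) (W s * adj (W t)) k" if "k \<ge> a" for k
      using base True that by (auto simp: zero_part_def avg_P_base adj_mult adj_adj intro: D)
    then show ?thesis by blast
  next
    case False
    have "zero_part (W s * adj (W t)) 0 k" if k: "k \<ge> max a b" for k
    proof -
      have "adj (V m) * (adj u * (W s * adj (W t)) * w) * V m = 0"
        if "u \<in> D k" "w \<in> D k" "m \<ge> k" for u w m
      proof -
        have "k - a \<noteq> k - b" "k - a \<le> m" "k - b \<le> m" "a \<le> k" "b \<le> k"
          using k that(3) False by auto
        then show ?thesis
          using V_compress_D[OF adj_W_mult_D[OF base(1) that(1)] adj_W_mult_D[OF base(2) that(2)], of m]
          by (simp add: adj_mult adj_adj mult.assoc)
      qed
      then show ?thesis using base False k by (auto simp: zero_part_def avg_P_base D_zero)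
    qed
    then show ?thesis by blast
  qed
next
  case (add x y)
  then obtain x0 y0 K K' where "\<forall>k\<ge>K. zero_part x x0 k" "\<forall>k\<ge>K'. zero_part y y0 k" by blast
  then have "\<forall>k\<ge>max K K'. zero_part (x + y) (x0 + y0) k"
    by (auto simp: zero_part_def avg_linear distrib_left distrib_right adj_add intro: D_add)
  then show ?case by blast
next
  case (scale c x)
  then obtain x0 K where "\<forall>k\<ge>K. zero_part x x0 k" by blast
  then have "\<forall>k\<ge>K. zero_part (c *\<^sub>C x) (c *\<^sub>C x0) k"
    by (auto simp: zero_part_def avg_linear mult_scaleC_left mult_scaleC_right adj_scaleC intro: D_scale)
  then show ?case by blast
qed

text \<open>On the matrix algebra acting on \<open>D k\<close> the operator norm is controlled by the sesquilinear
  form: powers of \<open>adj p * p\<close> turn the crude estimate by \<open>card (words k)\<close> into a sharp one.\<close>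

lemma norm_le_if_form_le:
  assumes p: "\<And>y. y \<in> D k \<Longrightarrow> p * y \<in> D k" "\<And>y. y \<in> D k \<Longrightarrow> adj p * y \<in> D k"
    and form: "\<And>y z. y \<in> D k \<Longrightarrow> z \<in> D k \<Longrightarrow> norm (adj y * p * z) \<le> d * norm y * norm z"
    and d: "0 \<le> d"
  shows "norm p \<le> d"
proof -
  \<comment> \<open>Testing the form against \<open>q * z\<close> itself turns the bound on the form
    into a bound on the vector.\<close>
  have bound: "norm (q * z) \<le> d * norm z"
    if q: "\<And>y. y \<in> D k \<Longrightarrow> q * y \<in> D k"
      "\<And>y z. y \<in> D k \<Longrightarrow> z \<in> D k \<Longrightarrow> norm (adj y * q * z) \<le> d * norm y * norm z"
      and z: "z \<in> D k" for q z
  proof (cases "q * z = 0")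
    case False
    have "norm (q * z) * norm (q * z) = norm (adj (q * z) * q * z)"
      using cstar_identity[of "q * z"] by (simp add: mult.assoc power2_eq_square)
    also have "\<dots> \<le> norm (q * z) * (d * norm z)"
      using q(2)[OF q(1)[OF z] z] by (simp add: mult_ac)
    finally show ?thesis using False by simp
  qed (use d in simp)
  define q where "q = adj p * p"
  have adj_form: "norm (adj y * adj p * z) \<le> d * norm y * norm z" if "y \<in> D k" "z \<in> D k" for y z
  proof -
    have "norm (adj y * adj p * z) = norm (adj (adj z * p * y))"
      by (simp add: adj_mult adj_adj mult.assoc)
    then show ?thesis using form[OF that(2,1)] by (simp add: mult_ac)
  qed
  have q_pow: "q ^ j * z \<in> D k \<and> norm (q ^ j * z) \<le> (d\<^sup>2) ^ j * norm z" if z: "z \<in> D k" for j z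
  proof (induction j)
    case (Suc j)
    define y where "y = q ^ j * z"
    have y: "y \<in> D k" "norm y \<le> (d\<^sup>2) ^ j * norm z" using Suc by (auto simp: y_def)
    have "norm (adj p * (p * y)) \<le> d * norm (p * y)"
      using p adj_form y(1) by (intro bound) auto
    also have "\<dots> \<le> d * (d * norm y)"
      using bound[OF p(1) form y(1)] d by (intro mult_left_mono) auto
    also have "\<dots> \<le> d * (d * ((d\<^sup>2) ^ j * norm z))"
      using y(2) d by (intro mult_left_mono) auto
    finally have "norm (q ^ Suc j * z) \<le> (d\<^sup>2) ^ Suc j * norm z"
      by (simp add: y_def q_def mult.assoc power2_eq_square)
    moreover have "q ^ Suc j * z \<in> D k"
      using p y(1) by (simp add: y_def q_def mult.assoc)
    ultimately show ?case by simp
  qed (use z in simp)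
  have crude: "norm (q ^ j) \<le> card (words k) * (d\<^sup>2) ^ j" for j
  proof -
    have "q ^ j = (\<Sum>s\<in>words k. q ^ j * W s * adj (W s))"
      using W_sum[of k] by (simp add: mult.assoc flip: sum_distrib_left)
    also have "norm \<dots> \<le> of_nat (card (words k)) * (d\<^sup>2) ^ j"
    proof (rule sum_norm_bound)
      fix s assume s: "s \<in> words k"
      then have "norm (W s) = 1" using W_orth[of s k s] by (intro norm_isometry) simp
      then show "norm (q ^ j * W s * adj (W s)) \<le> (d\<^sup>2) ^ j"
        using q_pow[OF W_in_D[OF s], of j] norm_mult_ineq[of "q ^ j * W s" "adj (W s)"] by simp
    qed
    finally show ?thesis .
  qed
  have "adj q = q" by (simp add: q_def adj_mult adj_adj)
  then have adj_pow: "adj (q ^ j) = q ^ j" for j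
    by (induction j) (simp_all add: adj_mult power_commutes)
  have "norm (q ^ 2 ^ j) = (norm q) ^ 2 ^ j" for j
  proof (induction j)
    case (Suc j)
    have "norm (q ^ 2 ^ Suc j) = norm (adj (q ^ 2 ^ j) * q ^ 2 ^ j)"
      by (simp add: adj_pow mult_2 flip: power_add)
    then show ?case by (simp add: cstar_identity Suc mult.commute flip: power_mult)
  qed simp
  then have "norm q \<le> d\<^sup>2"
    using crude by (intro le_if_dyadic_powers_le[of "norm q" "card (words k)"]) (metis, auto)
  then have "(norm p)\<^sup>2 \<le> d\<^sup>2" by (simp add: q_def cstar_identity)
  then show ?thesis using d by (rule power2_le_imp_le)
qed

section \<open>Simplicity of the fixed-point algebras\<close>

definition fixed :: "complex \<Rightarrow> 'a set" where
  "fixed s = {x. theta s x = x}"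

text \<open>Right multiplication by the even \<open>S 2\<close> and the odd \<open>S 1\<close>
  compensates the parities of the two components of \<open>u\<close>, and orthogonality of these
  generators keeps the components apart. The price is one more degree and a factor 2 in the
  norm.\<close>

lemma even_replacement:
  assumes s: "s = 1 \<or> s = - 1" and u: "u \<in> D k"
  obtains u0 u1 where "u = u0 + u1" "theta s u0 = u0" "theta s u1 = s *\<^sub>C u1" "s = 1 \<longrightarrow> u1 = 0"
    "u0 \<in> D k" "u1 \<in> D k"
    "u0 * S 2 + u1 * S 1 \<in> fixed s" "u0 * S 2 + u1 * S 1 \<in> D (Suc k)"
    "norm (u0 * S 2 + u1 * S 1) \<le> 2 * norm u"
proof -
  have s': "cmod s = 1" "s * s = 1" using s by auto
  note hom = star_hom_simps[OF theta_hom[OF s'(1)]]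
  define u0 u1 where "u0 = (1/2) *\<^sub>C (u + theta s u)" and "u1 = (1/2) *\<^sub>C (u - theta s u)"
  have sum: "u = u0 + u1"
    by (simp add: u0_def u1_def scaleC_add_right scaleC_diff_right flip: scaleC_add_left)
  have t0: "theta s u0 = u0" by (simp add: u0_def hom theta_theta[OF s] add.commute)
  have t1: "theta s u1 = s *\<^sub>C u1"
    using s by (auto simp: u1_def hom theta_theta[OF s] theta_one theta_theta[of "- 1"] scaleC_diff_right)
  have D: "u0 \<in> D k" "u1 \<in> D k"
    using u theta_D[OF s'(1) u] by (auto simp: u0_def u1_def intro: D_add D_diff D_scale)
  have "u0 * S 2 + u1 * S 1 \<in> fixed s"
    using letters s' by (simp add: fixed_def hom t0 t1 theta_S mult_scaleC_left mult_scaleC_right scaleC_scaleC)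
  moreover have "u0 * S 2 + u1 * S 1 \<in> D (Suc k)"
    using D_mult_W[of "[2]" 1 u0 k] D_mult_W[of "[1]" 1 u1 k] letters D
    by (simp add: words_def D_add)
  moreover have "norm (u0 * S 2 + u1 * S 1) \<le> 2 * norm u"
  proof -
    have "norm u0 \<le> norm u" "norm u1 \<le> norm u"
      using star_hom_norm_le[OF theta_hom[OF s'(1)], of u] norm_triangle_ineq[of u "theta s u"]
        norm_triangle_ineq4[of u "theta s u"] by (auto simp: u0_def u1_def norm_scaleC)
    moreover have "norm (S 2) = 1" "norm (S 1) = 1"
      using letters by (auto intro!: norm_isometry simp: S_orth)
    ultimately show ?thesis
      using norm_triangle_ineq[of "u0 * S 2" "u1 * S 1"] norm_mult_ineq[of u0 "S 2"]
        norm_mult_ineq[of u1 "S 1"] by simp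
  qed
  moreover have "s = 1 \<longrightarrow> u1 = 0" by (simp add: u1_def theta_one)
  ultimately show thesis using that[of u0 u1] sum t0 t1 D by simp
qed

lemma V_even_fixed: assumes "s = 1 \<or> s = - 1" shows "V (2 * m) \<in> fixed s"
proof -
  have s: "cmod s = 1" "s ^ (2 * m) = 1" using assms by (auto simp: power_mult)
  have "theta s (S 1 ^ j) = s ^ j *\<^sub>C S 1 ^ j" for j
    using s(1) letters
    by (induction j) (simp_all add: star_hom_simps[OF theta_hom] theta_S mult_scaleC_left mult_scaleC_right scaleC_scaleC mult.commute)
  then show ?thesis
    using s letters by (simp add: V_def spike_def fixed_def star_hom_mult[OF theta_hom] theta_S)
qed

text \<open>A polynomial approximating \<open>adj x * x\<close> has a degree-zero part with a large
  matrix coefficient. Compression between suitable vectors turns this coefficient into a scalar that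
  dominates the approximation error, and the vectors can be chosen invariant.\<close>

lemma compress_to_one:
  assumes s: "s = 1 \<or> s = - 1" and x: "x \<in> fixed s" "x \<noteq> 0"
  obtains u w where "u \<in> fixed s" "w \<in> fixed s" "norm (u * (adj x * x) * w - 1) < 1"
proof -
  have s': "cmod s = 1" using s by auto
  note hom = star_hom_simps[OF theta_hom[OF s']]
  define h where "h = adj x * x"
  have th: "theta s h = h" using x by (simp add: h_def hom fixed_def)
  obtain d where d: "d > 0" "\<And>M. M > 0 \<Longrightarrow> norm (avg M h) \<ge> d"
    using avg_lower_bound[OF x(2)] unfolding h_def by blast
  \<comment> \<open>Invariant vectors cost a factor 2 on each side, so the error is at most
    \<open>4 * (d / 16) = d / 4\<close> times \<open>norm u * norm w\<close>, while the coefficient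
    exceeds \<open>d / 2\<close> times the same product.\<close>
  obtain p' where p': "p' \<in> P" "norm (h - p') < d / 16" using P_dense[of "d / 16" h] d by auto
  \<comment> \<open>Symmetrizing does not increase the distance to the invariant \<open>h\<close>,
    and it makes the degree-zero part invariant.\<close>
  define p where "p = (1/2) *\<^sub>C (p' + theta s p')"
  have "p \<in> P" using p'(1) theta_P[OF s'] by (auto simp: p_def intro: P_scale P_add)
  have tp: "theta s p = p" by (simp add: p_def hom theta_theta[OF s] add.commute)
  have hp: "norm (h - p) \<le> d / 16"
  proof -
    have "h = (1/2) *\<^sub>C (h + theta s h)" by (simp add: th scaleC_add_right flip: scaleC_add_left)
    then have "h - p = (1/2) *\<^sub>C ((h - p') + theta s (h - p'))"
      unfolding p_def by (subst \<open>h = (1/2) *\<^sub>C (h + theta s h)\<close>)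
        (simp add: hom scaleC_diff_right scaleC_add_right algebra_simps)
    moreover have "norm ((h - p') + theta s (h - p')) \<le> 2 * norm (h - p')"
      using norm_triangle_ineq[of "h - p'" "theta s (h - p')"] star_hom_norm_le[OF theta_hom[OF s'], of "h - p'"]
      by simp
    ultimately have "norm (h - p) \<le> norm (h - p')" by (simp only: norm_scaleC) simp
    then show ?thesis using p'(2) by simp
  qed
  obtain p0 K where zp: "\<forall>k\<ge>K. zero_part p p0 k" using zero_part_exists[OF \<open>p \<in> P\<close>] by blast
  then have p0: "avg (Suc K) p = p0" "\<And>y. y \<in> D K \<Longrightarrow> p0 * y \<in> D K" "\<And>y. y \<in> D K \<Longrightarrow> adj p0 * y \<in> D K"
    by (auto simp: zero_part_def)
  have tp0: "theta s p0 = p0"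
    using p0(1) theta_avg[OF s', of "Suc K" p] tp by simp
  have "norm p0 > d / 2"
  proof -
    have "d \<le> norm (avg (Suc K) h)" by (rule d(2)) simp
    also have "avg (Suc K) h = avg (Suc K) (h - p) + p0"
      using p0(1) by (simp add: avg_linear)
    also have "norm \<dots> \<le> norm (h - p) + norm p0"
      using norm_triangle_ineq[of "avg (Suc K) (h - p)" p0] avg_norm_le[of "Suc K" "h - p"] by simp
    finally show ?thesis using hp d(1) by simp
  qed
  then obtain u w where uw: "u \<in> D K" "w \<in> D K" "norm (adj u * p0 * w) > d / 2 * norm u * norm w"
    using norm_le_if_form_le[of K p0 "d / 2"] p0(2,3) d(1) by fastforce
  define r where "r = norm u * norm w"
  obtain u0 u1 where u: "u = u0 + u1" "theta s u0 = u0" "theta s u1 = s *\<^sub>C u1" "s = 1 \<longrightarrow> u1 = 0"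
    "u0 \<in> D K" "u1 \<in> D K"
    "u0 * S 2 + u1 * S 1 \<in> fixed s" "u0 * S 2 + u1 * S 1 \<in> D (Suc K)"
    "norm (u0 * S 2 + u1 * S 1) \<le> 2 * norm u"
    by (rule even_replacement[OF s uw(1)])
  obtain w0 w1 where w: "w = w0 + w1" "theta s w0 = w0" "theta s w1 = s *\<^sub>C w1" "s = 1 \<longrightarrow> w1 = 0"
    "w0 \<in> D K" "w1 \<in> D K"
    "w0 * S 2 + w1 * S 1 \<in> fixed s" "w0 * S 2 + w1 * S 1 \<in> D (Suc K)"
    "norm (w0 * S 2 + w1 * S 1) \<le> 2 * norm w"
    by (rule even_replacement[OF s uw(2)])
  have scal: "\<exists>c. adj y * p0 * z = c *\<^sub>C 1" if "y \<in> D K" "z \<in> D K" for y z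
    using D_inner_scalar[OF that(1) p0(2)[OF that(2)]] by (metis mult.assoc)
  \<comment> \<open>These coefficients are scalars, hence fixed by \<open>theta s\<close>; for
    \<open>s = - 1\<close> they also change sign, pairing an even with an odd vector.\<close>
  have cross: "adj u0 * p0 * w1 = 0" "adj u1 * p0 * w0 = 0"
  proof -
    have fix_theta: "theta s (adj y * p0 * z) = adj y * p0 * z" if "y \<in> D K" "z \<in> D K" for y z
    proof -
      from scal[OF that] obtain c where c: "adj y * p0 * z = c *\<^sub>C 1" by blast
      show ?thesis
        unfolding c star_hom_scaleC[OF theta_hom[OF s']] star_hom_one[OF theta_hom[OF s']] ..
    qed
    show "adj u0 * p0 * w1 = 0"
    proof (cases "s = 1")
      case False
      then have "adj u0 * p0 * w1 = - (adj u0 * p0 * w1)"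
        using fix_theta[OF u(5) w(6)] s by (simp add: hom u w tp0)
      then show ?thesis by (metis add.right_inverse add_eq_0_iff scaleR_2 scaleR_eq_0_iff zero_neq_numeral)
    qed (simp add: w)
    show "adj u1 * p0 * w0 = 0"
    proof (cases "s = 1")
      case False
      then have "adj u1 * p0 * w0 = - (adj u1 * p0 * w0)"
        using fix_theta[OF u(6) w(5)] s by (simp add: hom u w tp0 adj_uminus)
      then show ?thesis by (metis add.right_inverse add_eq_0_iff scaleR_2 scaleR_eq_0_iff zero_neq_numeral)
    qed (simp add: u)
  qed
  obtain c0 c1 where c: "adj u0 * p0 * w0 = c0 *\<^sub>C 1" "adj u1 * p0 * w1 = c1 *\<^sub>C 1"
    using scal[OF u(5) w(5)] scal[OF u(6) w(6)] by blast
  define c where "c = c0 + c1"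
  define u' w' where "u' = u0 * S 2 + u1 * S 1" and "w' = w0 * S 2 + w1 * S 1"
  have "adj u * p0 * w = c *\<^sub>C 1"
    using cross c by (simp add: u(1) w(1) adj_add distrib_left distrib_right c_def scaleC_add_left)
  then have c_large: "cmod c > d / 2 * r" using uw(3) by (simp add: norm_scaleC r_def mult_ac)
  \<comment> \<open>The mixed terms vanish by \<open>cross\<close>; in the other two the middle
    factor is a scalar. So the passage to invariant vectors preserves the coefficient
    \<open>c\<close>.\<close>
  have "adj u' * p0 * w' = adj (S 2) * (adj u0 * p0 * w0) * S 2 + adj (S 1) * (adj u1 * p0 * w1) * S 1
      + adj (S 2) * (adj u0 * p0 * w1) * S 1 + adj (S 1) * (adj u1 * p0 * w0) * S 2"
    by (simp add: u'_def w'_def adj_add adj_mult distrib_left distrib_right mult.assoc)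
  also have "\<dots> = c *\<^sub>C 1"
    using letters unfolding cross c
    by (simp add: mult_scaleC_left mult_scaleC_right S_orth c_def scaleC_add_left)
  finally have u'w': "adj u' * p0 * w' = c *\<^sub>C 1" .
  \<comment> \<open>The even index makes \<open>v\<close> invariant, and \<open>2 * Suc K\<close> is
    at least the degree \<open>Suc K\<close> of \<open>u'\<close> and \<open>w'\<close>.\<close>
  define v where "v = V (2 * Suc K)"
  have vp: "adj v * (adj u' * p * w') * v = c *\<^sub>C 1"
    using zp[rule_format, of "Suc K"] u(8) w(8) u'w'
    by (simp add: zero_part_def v_def u'_def w'_def mult_scaleC_left mult_scaleC_right V_orth)
  have nv: "norm v = 1" unfolding v_def by (rule norm_isometry) (simp add: V_orth)
  have c0: "c \<noteq> 0" using c_large d(1) by (auto simp: r_def mult_less_0_iff zero_le_mult_iff not_less[symmetric])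
  have "norm (adj v * (adj u' * (h - p) * w') * v) \<le> norm v * ((norm u' * norm (h - p)) * norm w') * norm v"
    by (intro order_trans[OF norm_mult_ineq] mult_mono) (auto intro!: order_trans[OF norm_mult_ineq] mult_mono)
  also have "\<dots> = (norm u' * norm (h - p)) * norm w'" by (simp add: nv)
  also have "\<dots> \<le> ((2 * norm u) * (d / 16)) * (2 * norm w)"
    using u(9) w(9) hp d(1) by (intro mult_mono mult_nonneg_nonneg) (auto simp: u'_def w'_def)
  also have "\<dots> = d / 4 * r" by (simp add: r_def)
  also have "\<dots> \<le> d / 2 * r" using d(1) by (simp add: r_def)
  finally have "norm (adj v * (adj u' * (h - p) * w') * v) < cmod c" using c_large by simp
  moreover have "adj v * (adj u' * h * w') * v - c *\<^sub>C 1 = adj v * (adj u' * (h - p) * w') * v"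
    by (simp add: left_diff_distrib right_diff_distrib flip: vp)
  ultimately have close: "norm (adj v * (adj u' * h * w') * v - c *\<^sub>C 1) < cmod c" by simp
  define y where "y = (1 / c) *\<^sub>C (adj v * adj u')"
  have "y * h * (w' * v) - 1 = (1 / c) *\<^sub>C (adj v * (adj u' * h * w') * v - c *\<^sub>C 1)"
    using c0 by (simp add: y_def scaleC_diff_right scaleC_scaleC mult_scaleC_left mult.assoc)
  then have "norm (y * h * (w' * v) - 1) < 1"
    using close c0 by (simp only: norm_scaleC) (simp add: norm_divide field_simps)
  moreover have "v \<in> fixed s" unfolding v_def by (rule V_even_fixed[OF s])
  moreover have "u' \<in> fixed s" "w' \<in> fixed s" using u(7) w(7) by (auto simp: u'_def w'_def)
  ultimately show thesis
    using that[of y "w' * v"] by (simp add: h_def y_def fixed_def hom)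
qed

lemma cstar_subalgebra_fixed: assumes "cmod s = 1" shows "cstar_subalgebra (fixed s)"
proof -
  note hom = star_hom_simps[OF theta_hom[OF assms]]
  have "closed (fixed s)"
    unfolding fixed_def
    by (intro closed_Collect_eq linear_continuous_on star_hom_bounded_linear[OF theta_hom[OF assms]] continuous_intros)
  then show ?thesis
    by (auto simp: cstar_subalgebra_def complex_subspace_def fixed_def hom)
qed

text \<open>With \<open>y = 1 - x\<close>, all \<open>1 - y ^ k\<close> lie in the ideal, and they
  converge to 1 since \<open>norm y < 1\<close>.\<close>

lemma closed_ideal_contains_one:
  assumes "closed_ideal_of I B" "x \<in> I" "norm (x - 1) < 1" "cstar_subalgebra B" "1 \<in> B"
  shows "1 \<in> (I :: 'a set)"
proof -
  have I: "complex_subspace I" "closed I" "\<And>b x. b \<in> B \<Longrightarrow> x \<in> I \<Longrightarrow> b * x \<in> I" "I \<subseteq> B"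
    using assms(1) by (auto simp: closed_ideal_of_def)
  have B: "complex_subspace B" using assms(4) by (simp add: cstar_subalgebra_def)
  have diff: "a - b \<in> C" if "complex_subspace C" "a \<in> C" "b \<in> C" for a b and C :: "'a set"
    using that unfolding complex_subspace_def by (metis scaleC_minus_one diff_conv_add_uminus)
  define y where "y = 1 - x"
  have y: "y \<in> B" using diff[OF B assms(5)] assms(2) I(4) by (auto simp: y_def)
  have "norm y < 1" using assms(3) by (simp add: y_def norm_minus_commute)
  have ind: "1 - y ^ k \<in> I \<and> y ^ k \<in> B" for k
  proof (induction k)
    case 0
    then show ?case using I(1) assms(5) by (auto simp: complex_subspace_def)
  next
    case (Suc k)
    have "1 - y ^ Suc k = (1 - y ^ k) + y ^ k * x" unfolding power_Suc2 by (simp add: y_def right_diff_distrib)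
    moreover have "y ^ k * x \<in> I" using I(3) Suc assms(2) by blast
    ultimately have "1 - y ^ Suc k \<in> I" using I(1) Suc unfolding complex_subspace_def by metis
    then show ?case using Suc y assms(4) by (simp add: cstar_subalgebra_def)
  qed
  have "(\<lambda>k. y ^ k) \<longlonglongrightarrow> 0"
    using \<open>norm y < 1\<close> by (rule LIMSEQ_power_zero)
  then have "(\<lambda>k. 1 - y ^ k) \<longlonglongrightarrow> 1 - 0" by (intro tendsto_diff tendsto_const)
  then show ?thesis using closed_sequentially[OF I(2), of "\<lambda>k. 1 - y ^ k" 1] ind by simp
qed

lemma simple_fixed: assumes s: "s = 1 \<or> s = - 1" shows "simple_cstar (fixed s)"
proof -
  have s': "cmod s = 1" using s by auto
  note hom = star_hom_simps[OF theta_hom[OF s']]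
  have one: "1 \<in> fixed s" by (simp add: fixed_def hom)
  have "I = {0} \<or> I = fixed s" if I: "closed_ideal_of I (fixed s)" for I
  proof (cases "I = {0}")
    case False
    have "0 \<in> I" using I by (auto simp: closed_ideal_of_def complex_subspace_def)
    then obtain x where x: "x \<in> I" "x \<noteq> 0" using False by blast
    have ideal: "\<And>b x. b \<in> fixed s \<Longrightarrow> x \<in> I \<Longrightarrow> b * x \<in> I \<and> x * b \<in> I" and sub: "I \<subseteq> fixed s"
      using I by (auto simp: closed_ideal_of_def)
    obtain u w where uw: "u \<in> fixed s" "w \<in> fixed s" "norm (u * (adj x * x) * w - 1) < 1"
      using compress_to_one[OF s] x sub by blast
    have "adj x \<in> fixed s" using x sub by (auto simp: fixed_def hom)
    then have "u * (adj x * x) * w \<in> I" using ideal uw x by blast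
    then have "1 \<in> I"
      using closed_ideal_contains_one[OF I] uw(3) cstar_subalgebra_fixed[OF s'] one by blast
    then have "b \<in> I" if "b \<in> fixed s" for b using ideal[OF that, of 1] by simp
    then show ?thesis using sub by blast
  qed simp
  then show ?thesis using one unfolding simple_cstar_def by force
qed

end

text \<open>Re-indexing a quasi-basis allows products of index sets, as they arise for a composition
  of expectations.\<close>

lemma finite_watatani_indexI:
  fixes E :: "'a::unital_cstar_algebra \<Rightarrow> 'a"
  assumes "conditional_expectation B E" "finite I"
    "\<And>x. (\<Sum>i\<in>I. u i * E (v i * x)) = x" "\<And>x. (\<Sum>i\<in>I. E (x * u i) * v i) = x"
  shows "finite_watatani_index B"
proof -
  obtain h where h: "bij_betw h {1..card I} I"
    using ex_bij_betw_nat_finite_1[OF assms(2)] by blast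
  have "quasi_basis E (card I) (\<lambda>i. u (h i)) (\<lambda>i. v (h i))"
    unfolding quasi_basis_def
    using sum.reindex_bij_betw[OF h, of "\<lambda>i. u i * E (v i * _)"]
      sum.reindex_bij_betw[OF h, of "\<lambda>i. E (_ * u i) * v i"] assms(3,4) by simp
  then show ?thesis using assms(1) unfolding finite_watatani_index_def by blast
qed

lemma scaleC_half_double: "(1/2) *\<^sub>C (x + x) = (x :: 'a::unital_cstar_algebra)"
  by (simp add: scaleC_add_right flip: scaleC_add_left)

context cuntz
begin

section \<open>The twisted diagonal embedding\<close>

definition sw :: "nat \<Rightarrow> nat \<Rightarrow> nat" where
  "sw i j = (if j = 1 then i else if j = i then 1 else j)"

lemma sw_sw [simp]: "sw i (sw i j) = j"
  and sw_1 [simp]: "sw i 1 = i" "sw i (Suc 0) = i"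
  and sw_self [simp]: "sw i i = 1"
  and sw_1_left: "sw 1 j = j"
  by (auto simp: sw_def)

lemma sw_in_L: "i \<in> L \<Longrightarrow> j \<in> L \<Longrightarrow> sw i j \<in> L"
  using letters by (auto simp: sw_def)

lemma sw_eq_iff: "sw i j = sw i k \<longleftrightarrow> j = k"
  by (metis sw_sw)

definition alpha :: "nat \<Rightarrow> 'a \<Rightarrow> 'a" where
  "alpha i = endo (\<lambda>j. S (sw i j))"

lemma alpha_hom: "i \<in> L \<Longrightarrow> star_hom (alpha i)"
  and alpha_S: "i \<in> L \<Longrightarrow> j \<in> L \<Longrightarrow> alpha i (S j) = S (sw i j)"
proof -
  assume i: "i \<in> L"
  have "bij_betw (sw i) L L"
    by (rule bij_betwI[where g = "sw i"]) (auto simp: sw_in_L i)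
  then have "rels (\<lambda>j. S (sw i j))" using rels_monomial[of "sw i" "\<lambda>j. 1"] by simp
  from endo[OF this] show "star_hom (alpha i)" "j \<in> L \<Longrightarrow> alpha i (S j) = S (sw i j)"
    by (auto simp: alpha_def)
qed

lemma alpha_alpha: assumes "i \<in> L" shows "alpha i (alpha i x) = x"
proof -
  have "(\<lambda>x. alpha i (alpha i x)) = (\<lambda>x. x)"
    by (rule star_hom_eqI) (simp_all add: assms star_hom_compose alpha_hom star_hom_id alpha_S sw_in_L)
  then show ?thesis by metis
qed

lemma alpha_1: "alpha 1 x = x"
proof -
  have "alpha 1 = (\<lambda>x. x)"
    by (rule star_hom_eqI) (use letters in \<open>simp_all add: alpha_hom star_hom_id alpha_S sw_1_left[simplified]\<close>)
  then show ?thesis by simp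
qed

lemma eq_if_mult_S_eq:
  assumes "\<And>j. j \<in> L \<Longrightarrow> x * S j = y * S j" shows "x = (y :: 'a)"
proof -
  have "z = (\<Sum>j\<in>L. z * S j * adj (S j))" for z
    using S_sum by (simp add: mult.assoc flip: sum_distrib_left)
  then show ?thesis using assms by (metis (no_types, lifting) sum.cong)
qed

definition rho :: "'a \<Rightarrow> 'a" where
  "rho x = (\<Sum>i\<in>L. S i * alpha i x * adj (S i))"

lemma finite_L: "finite L"
  by (simp add: L_def)

text \<open>\<open>S j\<close> intertwines \<open>alpha j\<close> with \<open>rho\<close>: the map
  \<open>rho\<close> is the direct sum of the \<open>alpha j\<close>, and the \<open>S j\<close> are
  the inclusions of the summands.\<close>

lemma rho_mult_S: "j \<in> L \<Longrightarrow> rho x * S j = S j * alpha j x"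
  using finite_L
  by (simp add: rho_def sum_distrib_right mult.assoc S_orth if_distrib cong: if_cong)

lemma rho_mult_S': "j \<in> L \<Longrightarrow> rho x * (S j * y) = S j * (alpha j x * y)"
  using rho_mult_S[of j x] by (simp flip: mult.assoc)

lemma rho_hom: "star_hom rho"
  unfolding star_hom_iff
proof (intro conjI allI)
  show "rho (x + y) = rho x + rho y" for x y
    by (simp add: rho_def star_hom_add[OF alpha_hom] distrib_left distrib_right sum.distrib)
  show "rho (c *\<^sub>C x) = c *\<^sub>C rho x" for c x
    by (simp add: rho_def star_hom_scaleC[OF alpha_hom] mult_scaleC_left mult_scaleC_right scaleC_sum_right)
  show "rho 1 = 1" by (simp add: rho_def star_hom_one[OF alpha_hom] S_sum)
  show "rho (adj x) = adj (rho x)" for x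
    by (simp add: rho_def star_hom_adj[OF alpha_hom] adj_sum adj_mult adj_adj mult.assoc)
  show "rho (x * y) = rho x * rho y" for x y
  proof (rule eq_if_mult_S_eq)
    fix j assume j: "j \<in> L"
    have "rho x * rho y * S j = rho x * S j * alpha j y" by (simp add: mult.assoc rho_mult_S rho_mult_S' j)
    then show "rho (x * y) * S j = rho x * rho y * S j"
      by (simp add: rho_mult_S rho_mult_S' j star_hom_mult[OF alpha_hom] mult.assoc)
  qed
qed

lemma adj_S_mult_rho: assumes "i \<in> L" shows "adj (S i) * rho x = alpha i x * adj (S i)"
proof -
  have "adj (rho (adj x) * S i) = adj (S i * alpha i (adj x))" by (simp add: rho_mult_S assms)
  then show ?thesis
    by (simp add: adj_mult star_hom_adj[OF rho_hom] star_hom_adj[OF alpha_hom] assms adj_adj)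
qed

lemma rho_left_inverse: "adj (S 1) * rho x * S 1 = x"
  using letters by (simp only: adj_S_mult_rho alpha_1 mult.assoc) (simp add: S_orth)

lemma rho_inj: "rho x = rho y \<longleftrightarrow> x = y"
  by (metis rho_left_inverse)

lemma cstar_subalgebra_rho:
  assumes "cstar_subalgebra C" shows "cstar_subalgebra (rho ` C)"
proof -
  note hom = star_hom_simps[OF rho_hom]
  have lin: "bounded_linear (\<lambda>y. adj (S 1) * y * S 1)"
    by (rule bounded_linear_compose[OF bounded_linear_mult_left bounded_linear_mult_right])
  note cont = linear_continuous_on[OF lin] linear_continuous_on[OF bounded_linear_compose[OF star_hom_bounded_linear[OF rho_hom] lin]]
  \<comment> \<open>The continuous left inverse of \<open>rho\<close> cuts out the image by closed
    conditions.\<close>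
  have "rho ` C = {y. rho (adj (S 1) * y * S 1) = y} \<inter> (\<lambda>y. adj (S 1) * y * S 1) -` C"
    by (auto simp: rho_left_inverse simp del: One_nat_def) (metis image_eqI)
  moreover have "closed C" using assms by (simp add: cstar_subalgebra_def)
  ultimately have "closed (rho ` C)"
    by (simp only:) (intro closed_Int closed_Collect_eq closed_vimage cont continuous_intros)
  then show ?thesis
    using assms unfolding cstar_subalgebra_def complex_subspace_def
    by (auto simp flip: hom(1-5) intro!: image_eqI[where x = 0] simp: hom(6))
qed

lemma simple_rho:
  assumes "simple_cstar C" "cstar_subalgebra C" shows "simple_cstar (rho ` C)"
proof -
  note hom = star_hom_simps[OF rho_hom]
  have "rho ` C \<noteq> {0}"
  proof
    assume "rho ` C = {0}"
    then have "C = {0}" using rho_inj hom(6) by (metis image_empty image_insert inj_image_eq_iff inj_def)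
    then show False using assms(1) by (simp add: simple_cstar_def)
  qed
  moreover have "I = {0} \<or> I = rho ` C" if I: "closed_ideal_of I (rho ` C)" for I
  proof -
    define J where "J = C \<inter> rho -` I"
    have sub: "I \<subseteq> rho ` C" using I by (simp add: closed_ideal_of_def)
    have IJ: "I = rho ` J" using sub by (auto simp: J_def)
    have "closed J"
      unfolding J_def using assms(2) I
      by (intro closed_Int closed_vimage linear_continuous_on star_hom_bounded_linear[OF rho_hom])
        (auto simp: cstar_subalgebra_def closed_ideal_of_def)
    then have "closed_ideal_of J C"
      using I assms(2)
      by (auto simp: closed_ideal_of_def complex_subspace_def cstar_subalgebra_def J_def hom)
    then have "J = {0} \<or> J = C" using assms(1) by (simp add: simple_cstar_def)
    then show ?thesis using IJ hom(6) by auto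
  qed
  ultimately show ?thesis by (simp add: simple_cstar_def)
qed

section \<open>Finite index\<close>

text \<open>The mean of the left inverses of \<open>rho\<close> given by the summands, where
  \<open>alpha k\<close> is its own inverse. Followed by \<open>rho\<close> it is an expectation
  onto the range of \<open>rho\<close>. All summands have to contribute, since compression by one
  \<open>S k\<close> annihilates the range projections of the others.\<close>

definition slice :: "'a \<Rightarrow> 'a" where
  "slice x = (1 / of_nat n) *\<^sub>C (\<Sum>k\<in>L. alpha k (adj (S k) * x * S k))"

lemma card_L: "card L = n"
  by (simp add: L_def)

lemma slice_add: "slice (x + y) = slice x + slice y"
  and slice_scaleC: "slice (c *\<^sub>C x) = c *\<^sub>C slice x"
  by (simp_all add: slice_def star_hom_simps[OF alpha_hom] distrib_left distrib_right sum.distrib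
      scaleC_add_right mult_scaleC_left mult_scaleC_right scaleC_scaleC mult.commute flip: scaleC_sum_right)

lemma slice_rho_left: "slice (rho b * x) = b * slice x"
proof -
  have "alpha k (adj (S k) * (rho b * x) * S k) = b * alpha k (adj (S k) * x * S k)" if "k \<in> L" for k
  proof -
    have "adj (S k) * (rho b * x) * S k = alpha k b * (adj (S k) * x * S k)"
      using adj_S_mult_rho[OF that, of b] by (simp flip: mult.assoc)
    then show ?thesis using that by (simp only: star_hom_mult[OF alpha_hom] alpha_alpha)
  qed
  then show ?thesis by (simp add: slice_def mult_scaleC_right sum_distrib_left)
qed

lemma slice_rho_right: "slice (x * rho b) = slice x * b"
proof -
  have "alpha k (adj (S k) * (x * rho b) * S k) = alpha k (adj (S k) * x * S k) * b" if "k \<in> L" for k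
  proof -
    have "adj (S k) * (x * rho b) * S k = (adj (S k) * x * S k) * alpha k b"
      using rho_mult_S[OF that, of b] by (simp add: mult.assoc)
    then show ?thesis using that by (simp only: star_hom_mult[OF alpha_hom] alpha_alpha)
  qed
  then show ?thesis by (simp add: slice_def mult_scaleC_left sum_distrib_right)
qed

lemma slice_one: "slice 1 = 1"
proof -
  have "(of_nat n :: 'a) = of_nat n *\<^sub>C 1"
    using scaleR_scaleC[of "real n" "1 :: 'a"] by (simp add: scaleR_conv_of_real[of _ "1 :: 'a"])
  then have "(\<Sum>k\<in>L. alpha k (adj (S k) * 1 * S k)) = of_nat n *\<^sub>C 1"
    by (simp add: S_orth star_hom_one[OF alpha_hom] card_L)
  then show ?thesis using n2 by (simp add: slice_def scaleC_scaleC)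
qed

text \<open>The generators put the elements \<open>alpha k (x * S k)\<close> into orthogonal
  positions, so that the sum of their squares is the square of the single element
  \<open>z\<close>.\<close>

lemma slice_positive: obtains w where "slice (adj x * x) = adj w * w"
proof -
  define z where "z = (\<Sum>k\<in>L. S k * alpha k (x * S k))"
  define r where "r = complex_of_real (1 / sqrt n)"
  have "adj z * z = (\<Sum>k\<in>L. adj (alpha k (x * S k)) * alpha k (x * S k))"
    using finite_L
    by (simp add: z_def adj_sum sum_distrib_left sum_distrib_right adj_mult mult.assoc S_orth' if_distrib cong: if_cong)
  also have "\<dots> = (\<Sum>k\<in>L. alpha k (adj (S k) * (adj x * x) * S k))"
    by (intro sum.cong) (simp_all add: star_hom_simps[OF alpha_hom] adj_mult mult.assoc)
  finally have "slice (adj x * x) = (1 / of_nat n) *\<^sub>C (adj z * z)" by (simp add: slice_def)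
  also have "(1 / of_nat n :: complex) = cnj r * r"
    by (simp add: r_def flip: of_real_mult)
  finally have "slice (adj x * x) = adj (r *\<^sub>C z) * (r *\<^sub>C z)"
    by (simp add: adj_scaleC mult_scaleC_left mult_scaleC_right scaleC_scaleC mult.commute)
  then show thesis using that by blast
qed

lemma slice_single:
  assumes "k \<in> L" shows "slice (S k * x) = (1 / of_nat n) *\<^sub>C alpha k (x * S k)"
    "slice (x * adj (S k)) = (1 / of_nat n) *\<^sub>C alpha k (adj (S k) * x)"
proof -
  have "(\<Sum>j\<in>L. alpha j (adj (S j) * (S k * x) * S j)) = (\<Sum>j\<in>L. if j = k then alpha k (x * S k) else 0)"
    by (intro sum.cong) (auto simp: mult.assoc S_orth' assms star_hom_zero[OF alpha_hom])
  then show "slice (S k * x) = (1 / of_nat n) *\<^sub>C alpha k (x * S k)"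
    using finite_L assms by (simp add: slice_def)
  have "(\<Sum>j\<in>L. alpha j (adj (S j) * (x * adj (S k)) * S j)) = (\<Sum>j\<in>L. if j = k then alpha k (adj (S k) * x) else 0)"
    by (intro sum.cong) (auto simp: mult.assoc S_orth assms star_hom_zero[OF alpha_hom])
  then show "slice (x * adj (S k)) = (1 / of_nat n) *\<^sub>C alpha k (adj (S k) * x)"
    using finite_L assms by (simp add: slice_def)
qed

text \<open>Quasi-bases multiply along a tower of expectations: the pairs
  \<open>of_nat n *\<^sub>C (S i * adj (S k))\<close>, \<open>S k * adj (S i)\<close> serve the
  expectation \<open>slice\<close> followed by \<open>rho\<close>, and the images under
  \<open>rho\<close> of the given pairs serve \<open>F\<close>.\<close>

lemma finite_index_rho:
  assumes "finite_watatani_index C" shows "finite_watatani_index (rho ` C)"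
proof -
  obtain F m u v where F: "conditional_expectation C F" and qb: "quasi_basis F m u v"
    using assms by (auto simp: finite_watatani_index_def)
  note hom = star_hom_simps[OF rho_hom]
  have n0: "(of_nat n :: complex) \<noteq> 0" using n2 by simp
  define E where "E x = rho (F (slice x))" for x
  have E: "conditional_expectation (rho ` C) E"
    unfolding conditional_expectation_def
  proof (intro conjI allI ballI)
    note F' = F[unfolded conditional_expectation_def]
    show "E x \<in> rho ` C" for x using F' by (simp add: E_def)
    show "E (x + y) = E x + E y" for x y using F' by (simp add: E_def slice_add hom)
    show "E (c *\<^sub>C x) = c *\<^sub>C E x" for c x using F' by (simp add: E_def slice_scaleC hom)
    fix b assume "b \<in> rho ` C"
    then obtain a where a: "a \<in> C" "b = rho a" by blast
    show "E b = b" using F' a slice_rho_left[of a 1] by (simp add: E_def slice_one)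
    show "E (b * x) = b * E x" for x using F' a by (simp add: E_def slice_rho_left hom)
    show "E (x * b) = E x * b" for x using F' a by (simp add: E_def slice_rho_right hom)
  next
    fix x :: 'a
    obtain w where w: "slice (adj x * x) = adj w * w" using slice_positive[of x] .
    obtain y where "y \<in> C" "F (adj w * w) = adj y * y"
      using F unfolding conditional_expectation_def by blast
    then show "\<exists>y\<in>rho ` C. E (adj x * x) = adj y * y" by (auto simp: E_def w hom)
  qed
  have inner: "(\<Sum>l=1..m. rho (u l) * E (rho (v l) * y)) = rho (slice y)"
    "(\<Sum>l=1..m. E (y * rho (u l)) * rho (v l)) = rho (slice y)" for y
    using qb by (simp_all add: E_def slice_rho_left slice_rho_right quasi_basis_def flip: hom(2) hom(9))
  define u' where "u' = (\<lambda>(i, k, l). of_nat n *\<^sub>C (S i * adj (S k) * rho (u l)))"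
  define v' where "v' = (\<lambda>(i, k, l). rho (v l) * S k * adj (S i))"
  have triple: "sum f (L \<times> L \<times> A) = (\<Sum>i\<in>L. \<Sum>k\<in>L. \<Sum>l\<in>A. f (i, k, l))"
    for f :: "nat \<times> nat \<times> nat \<Rightarrow> 'a" and A
    by (simp add: sum.cartesian_product split_def)
  have lin: "E (c *\<^sub>C y) = c *\<^sub>C E y" for c y
    using E by (simp add: conditional_expectation_def)
  show ?thesis
  proof (rule finite_watatani_indexI[OF E, where I = "L \<times> L \<times> {1..m}" and u = u' and v = v'])
    show "finite (L \<times> L \<times> {1..m})" using finite_L by simp
    fix x :: 'a
    have "(\<Sum>p\<in>L \<times> L \<times> {1..m}. u' p * E (v' p * x))
        = (\<Sum>i\<in>L. \<Sum>k\<in>L. of_nat n *\<^sub>C (S i * adj (S k) * (\<Sum>l=1..m. rho (u l) * E (rho (v l) * (S k * (adj (S i) * x))))))"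
      by (simp add: triple u'_def v'_def mult_scaleC_left sum_distrib_left
          scaleC_sum_right mult.assoc)
    also have "\<dots> = (\<Sum>i\<in>L. \<Sum>k\<in>L. S i * adj (S i) * (x * (S k * adj (S k))))"
    proof (intro sum.cong refl)
      fix i k assume ik: "i \<in> L" "k \<in> L"
      have "S i * adj (S k) * rho (slice (S k * (adj (S i) * x)))
          = (1 / of_nat n) *\<^sub>C (S i * (adj (S k) * rho (alpha k (adj (S i) * x * S k))))"
        by (simp add: slice_single ik hom mult_scaleC_right mult.assoc)
      also have "\<dots> = (1 / of_nat n) *\<^sub>C (S i * adj (S i) * (x * (S k * adj (S k))))"
        by (simp only: adj_S_mult_rho[OF ik(2)] alpha_alpha[OF ik(2)]) (simp add: mult.assoc)
      finally show "of_nat n *\<^sub>C (S i * adj (S k) * (\<Sum>l=1..m. rho (u l) * E (rho (v l) * (S k * (adj (S i) * x)))))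
          = S i * adj (S i) * (x * (S k * adj (S k)))"
        using n0 by (simp only: inner) (simp add: scaleC_scaleC)
    qed
    also have "\<dots> = x"
      by (simp add: S_sum flip: sum_distrib_left sum_distrib_right)
    finally show "(\<Sum>p\<in>L \<times> L \<times> {1..m}. u' p * E (v' p * x)) = x" .
    have "(\<Sum>p\<in>L \<times> L \<times> {1..m}. E (x * u' p) * v' p)
        = (\<Sum>i\<in>L. \<Sum>k\<in>L. of_nat n *\<^sub>C ((\<Sum>l=1..m. E (x * S i * adj (S k) * rho (u l)) * rho (v l)) * (S k * adj (S i))))"
      by (simp add: triple u'_def v'_def mult_scaleC_left mult_scaleC_right lin
          sum_distrib_right scaleC_sum_right mult.assoc)
    also have "\<dots> = (\<Sum>i\<in>L. \<Sum>k\<in>L. S k * adj (S k) * (x * (S i * adj (S i))))"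
    proof (intro sum.cong refl)
      fix i k assume ik: "i \<in> L" "k \<in> L"
      have "rho (slice (x * S i * adj (S k))) * (S k * adj (S i))
          = (1 / of_nat n) *\<^sub>C (rho (alpha k (adj (S k) * (x * S i))) * S k * adj (S i))"
        by (simp only: slice_single(2)[OF ik(2)] hom(4) mult_scaleC_left) (simp add: mult.assoc)
      also have "\<dots> = (1 / of_nat n) *\<^sub>C (S k * adj (S k) * (x * (S i * adj (S i))))"
        by (simp only: rho_mult_S[OF ik(2)] alpha_alpha[OF ik(2)]) (simp add: mult.assoc)
      finally show "of_nat n *\<^sub>C ((\<Sum>l=1..m. E (x * S i * adj (S k) * rho (u l)) * rho (v l)) * (S k * adj (S i)))
          = S k * adj (S k) * (x * (S i * adj (S i)))"
        using n0 by (simp only: inner) (simp add: scaleC_scaleC)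
    qed
    also have "\<dots> = x"
      by (simp add: S_sum flip: sum_distrib_left sum_distrib_right)
    finally show "(\<Sum>p\<in>L \<times> L \<times> {1..m}. E (x * u' p) * v' p) = x" .
  qed
qed

lemma fixed_1: "fixed 1 = UNIV"
  by (simp add: fixed_def theta_one)

lemma finite_index_UNIV: "finite_watatani_index (UNIV :: 'a set)"
proof (rule finite_watatani_indexI[where E = "\<lambda>x. x" and I = "{0::nat}" and u = "\<lambda>_. 1" and v = "\<lambda>_. 1"])
  show "conditional_expectation UNIV (\<lambda>x::'a. x)"
    by (auto simp: conditional_expectation_def)
qed simp_all

text \<open>Since \<open>S 1\<close> is an odd isometry, \<open>adj (S 1) * F (S 1 * x)\<close> is
  the odd part of \<open>x\<close>, while \<open>F x\<close> is its even part. Together they recover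
  \<open>x\<close>, which gives a quasi-basis with two pairs.\<close>

lemma finite_index_fixed: "finite_watatani_index (fixed (- 1))"
proof -
  have s: "cmod (- 1) = 1" by simp
  note hom = star_hom_simps[OF theta_hom[OF s]]
  let ?\<theta> = "theta (- 1)"
  have inv: "?\<theta> (?\<theta> x) = x" for x by (rule theta_theta) simp
  have S1: "?\<theta> (S 1) = - S 1" and S2: "?\<theta> (S 2) = S 2" using letters by (simp_all add: theta_S)
  define F where "F x = (1/2) *\<^sub>C (x + ?\<theta> x)" for x
  have F: "conditional_expectation (fixed (- 1)) F"
    unfolding conditional_expectation_def
  proof (intro conjI allI ballI)
    show "F x \<in> fixed (- 1)" for x by (simp add: F_def fixed_def hom inv add.commute)
    show "F (x + y) = F x + F y" for x y by (simp add: F_def hom scaleC_add_right)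
    show "F (c *\<^sub>C x) = c *\<^sub>C F x" for c x by (simp add: F_def hom scaleC_add_right scaleC_scaleC)
    fix b assume b: "b \<in> fixed (- 1)"
    show "F b = b" using b scaleC_half_double[of b] by (simp add: F_def fixed_def)
    show "F (b * x) = b * F x" "F (x * b) = F x * b" for x
      using b by (simp_all add: F_def fixed_def hom mult_scaleC_right mult_scaleC_left distrib_left distrib_right)
  next
    fix x :: 'a
    define x0 x1 where "x0 = F x" and "x1 = (1/2) *\<^sub>C (x - ?\<theta> x)"
    have x: "x = x0 + x1" "?\<theta> x = x0 - x1"
      using scaleC_half_double[of x] scaleC_half_double[of "?\<theta> x"]
      by (simp_all add: x0_def x1_def F_def scaleC_add_right scaleC_diff_right)
    have t: "?\<theta> x0 = x0" "?\<theta> x1 = - x1"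
      by (simp_all add: x0_def x1_def F_def hom inv scaleC_add_right scaleC_diff_right)
    \<comment> \<open>\<open>F (adj x * x)\<close> is the sum of the squares of the even part
      \<open>x0\<close> and the odd part \<open>x1\<close>; the odd \<open>S 1\<close> makes the
      second entry even, so the root lies in the fixed algebra.\<close>
    define y where "y = S 2 * x0 + S 1 * x1"
    have "adj (x0 + x1) * (x0 + x1) + adj (x0 - x1) * (x0 - x1)
        = (adj x0 * x0 + adj x1 * x1) + (adj x0 * x0 + adj x1 * x1)"
      by (simp add: adj_add adj_diff algebra_simps)
    note this[folded x]
    then have "F (adj x * x) = adj x0 * x0 + adj x1 * x1"
      by (simp only: F_def hom(2,5) scaleC_half_double)
    also have "\<dots> = adj y * y"
      using letters by (simp add: y_def adj_add adj_mult distrib_left distrib_right mult.assoc S_orth')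
    finally have "F (adj x * x) = adj y * y" .
    moreover have "y \<in> fixed (- 1)" by (simp add: y_def fixed_def hom S1[simplified] S2 t)
    ultimately show "\<exists>y\<in>fixed (- 1). F (adj x * x) = adj y * y" by blast
  qed
  show ?thesis
  proof (rule finite_watatani_indexI[OF F, where I = "UNIV :: bool set"
        and u = "\<lambda>b. if b then 1 else adj (S 1)" and v = "\<lambda>b. if b then 1 else S 1"])
    fix x :: 'a
    have half: "(1/2) *\<^sub>C x + (1/2) *\<^sub>C x = x" using scaleC_half_double[of x] by (simp add: scaleC_add_right)
    show "(\<Sum>b\<in>UNIV. (if b then 1 else adj (S 1)) * F ((if b then 1 else S 1) * x)) = x"
      using letters half
      by (simp add: UNIV_bool F_def hom S1[simplified] S_orth' mult_scaleC_right scaleC_add_right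
          scaleC_diff_right scaleC_uminus_right distrib_left)
    show "(\<Sum>b\<in>UNIV. F (x * (if b then 1 else adj (S 1))) * (if b then 1 else S 1)) = x"
      using letters half
      by (simp add: UNIV_bool F_def hom S1[simplified] S_orth mult_scaleC_left scaleC_add_right
          scaleC_diff_right scaleC_uminus_right distrib_right adj_uminus mult.assoc)
  qed simp
qed

section \<open>Intertwiners of quasi-free automorphisms\<close>

lemma obtain_other_letter: obtains b where "b \<in> L" "b \<noteq> a"
  using letters by (metis numeral_One numeral_eq_iff semiring_norm(85))

text \<open>Iterating the relation along a word \<open>a\<dots>ab\<close> reproduces
  \<open>y\<close>, up to a phase, as a compression by spikes; hence \<open>y\<close> is a scalar. A
  nonzero scalar would force the two families of generators to coincide letter by letter.\<close>

lemma intertwiner: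
  assumes \<pi>: "\<And>l. l \<in> L \<Longrightarrow> \<pi> l \<in> L" "inj_on \<pi> L"
    and \<pi>': "\<And>l. l \<in> L \<Longrightarrow> \<pi>' l \<in> L" "inj_on \<pi>' L"
    and c: "\<And>l. l \<in> L \<Longrightarrow> cmod (c l) = 1" "\<And>l. l \<in> L \<Longrightarrow> cmod (c' l) = 1"
    and y: "\<And>l. l \<in> L \<Longrightarrow> c l *\<^sub>C (S (\<pi> l) * y) = c' l *\<^sub>C (y * S (\<pi>' l))"
  shows "\<exists>k. y = k *\<^sub>C 1"
    and "l \<in> L \<Longrightarrow> \<pi> l \<noteq> \<pi>' l \<or> c l \<noteq> c' l \<Longrightarrow> y = 0"
proof -
  have step: "y = (cnj (c l) * c' l) *\<^sub>C (adj (S (\<pi> l)) * y * S (\<pi>' l))" if l: "l \<in> L" for l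
  proof -
    have cc: "cnj (c l) * c l = 1"
      using c(1)[OF l] by (simp add: complex_norm_square[symmetric] mult.commute)
    have "(cnj (c l) * c' l) *\<^sub>C (adj (S (\<pi> l)) * y * S (\<pi>' l))
        = cnj (c l) *\<^sub>C (adj (S (\<pi> l)) * (c' l *\<^sub>C (y * S (\<pi>' l))))"
      by (simp add: mult_scaleC_right scaleC_scaleC mult.assoc)
    also have "\<dots> = y"
      unfolding y[OF l, symmetric] by (simp add: mult_scaleC_right scaleC_scaleC cc S_orth' \<pi> l)
    finally show ?thesis by simp
  qed
  have spikes: "\<exists>k. cmod k = 1 \<and> y = k *\<^sub>C (adj (spike (\<pi> a) (\<pi> b) m) * y * spike (\<pi>' a) (\<pi>' b) m)"
    if ab: "a \<in> L" "b \<in> L" for a b m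
  proof (induction m)
    case 0
    then show ?case
      using step[OF ab(2)] c ab(2)
      by (intro exI[of _ "cnj (c b) * c' b"]) (simp add: spike_def norm_mult)
  next
    case (Suc m)
    then obtain k where k: "cmod k = 1"
      "y = k *\<^sub>C (adj (spike (\<pi> a) (\<pi> b) m) * y * spike (\<pi>' a) (\<pi>' b) m)" by blast
    define d where "d = cnj (c a) * c' a"
    have "adj (spike (\<pi> a) (\<pi> b) m) * (d *\<^sub>C (adj (S (\<pi> a)) * y * S (\<pi>' a))) * spike (\<pi>' a) (\<pi>' b) m
        = d *\<^sub>C (adj (spike (\<pi> a) (\<pi> b) (Suc m)) * y * spike (\<pi>' a) (\<pi>' b) (Suc m))"
      by (simp add: spike_Suc adj_mult mult_scaleC_left mult_scaleC_right mult.assoc)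
    then have "adj (spike (\<pi> a) (\<pi> b) m) * y * spike (\<pi>' a) (\<pi>' b) m
        = d *\<^sub>C (adj (spike (\<pi> a) (\<pi> b) (Suc m)) * y * spike (\<pi>' a) (\<pi>' b) (Suc m))"
      unfolding d_def step[OF ab(1), symmetric] .
    then have "y = (k * d) *\<^sub>C (adj (spike (\<pi> a) (\<pi> b) (Suc m)) * y * spike (\<pi>' a) (\<pi>' b) (Suc m))"
      using k(2) by (simp add: scaleC_scaleC)
    moreover have "cmod (k * d) = 1" using k(1) c ab(1) by (simp add: d_def norm_mult)
    ultimately show ?case by blast
  qed
  have scalar: "\<exists>k. y = k *\<^sub>C 1 \<and> (\<pi> a \<noteq> \<pi>' a \<longrightarrow> k = 0)" if a: "a \<in> L" for a
  proof -
    obtain b where b: "b \<in> L" "b \<noteq> a" by (rule obtain_other_letter)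
    have ne: "\<pi> a \<noteq> \<pi> b" "\<pi>' a \<noteq> \<pi>' b" using \<pi>(2) \<pi>'(2) a b by (auto simp: inj_on_def)
    have per: "\<exists>m'\<ge>m. \<exists>k. cmod k = 1 \<and>
        y = k *\<^sub>C (adj (spike (\<pi> a) (\<pi> b) m') * y * spike (\<pi>' a) (\<pi>' b) m')" for m
      using spikes[OF a b(1), of m] by blast
    obtain k where "y = k *\<^sub>C 1" "\<pi> a \<noteq> \<pi>' a \<Longrightarrow> k = 0"
      using spike_fixed_scalar[OF \<pi>(1)[OF a] \<pi>(1)[OF b(1)] \<pi>'(1)[OF a] \<pi>'(1)[OF b(1)] ne per]
      by blast
    then show ?thesis by blast
  qed
  show "\<exists>k. y = k *\<^sub>C 1" using scalar[OF letters(1)] by blast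
  assume l: "l \<in> L" and ne: "\<pi> l \<noteq> \<pi>' l \<or> c l \<noteq> c' l"
  obtain k where k: "y = k *\<^sub>C 1" "\<pi> l \<noteq> \<pi>' l \<longrightarrow> k = 0" using scalar[OF l] by blast
  show "y = 0"
  proof (cases "\<pi> l = \<pi>' l")
    case True
    have "(c l * k) *\<^sub>C S (\<pi> l) = (c' l * k) *\<^sub>C S (\<pi> l)"
      using y[OF l] k(1) True by (simp add: mult_scaleC_left mult_scaleC_right scaleC_scaleC)
    then have "((c l - c' l) * k) *\<^sub>C S (\<pi> l) = 0"
      by (simp add: left_diff_distrib scaleC_diff_left)
    then show ?thesis using k(1) ne True S_nonzero[OF \<pi>(1)[OF l]] by auto
  qed (use k in simp)
qed

text \<open>The relations for all letters and the completeness relation of \<open>T\<close> together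
  express \<open>adj (S (\<pi> l)) * b\<close> as a multiple of \<open>b * adj (T l)\<close>; its
  adjoint is the claim.\<close>

lemma intertwiner_adj:
  assumes "rels T" "\<And>l. l \<in> L \<Longrightarrow> \<pi> l \<in> L" "inj_on \<pi> L" "\<And>l. l \<in> L \<Longrightarrow> cmod (c l) = 1"
    and b: "\<And>l. l \<in> L \<Longrightarrow> c l *\<^sub>C (S (\<pi> l) * b) = b * T l"
    and l: "l \<in> L"
  shows "c l *\<^sub>C (adj b * S (\<pi> l)) = T l * adj b"
proof -
  have "adj (S (\<pi> l)) * b = (\<Sum>m\<in>L. adj (S (\<pi> l)) * (b * T m) * adj (T m))"
    using assms(1) by (simp add: rels_def mult.assoc flip: sum_distrib_left)
  also have "\<dots> = (\<Sum>m\<in>L. if m = l then c l *\<^sub>C (b * adj (T l)) else 0)"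
  proof (intro sum.cong refl)
    fix m assume m: "m \<in> L"
    have "\<pi> l = \<pi> m \<longleftrightarrow> m = l" using assms(3) l m by (auto simp: inj_on_def)
    then show "adj (S (\<pi> l)) * (b * T m) * adj (T m) = (if m = l then c l *\<^sub>C (b * adj (T l)) else 0)"
      unfolding b[OF m, symmetric]
      by (auto simp: mult_scaleC_left mult_scaleC_right mult.assoc S_orth' assms(2) l m)
  qed
  also have "\<dots> = c l *\<^sub>C (b * adj (T l))" using l finite_L by simp
  finally have "adj (adj (S (\<pi> l)) * b) = adj (c l *\<^sub>C (b * adj (T l)))" by simp
  then have "adj b * S (\<pi> l) = cnj (c l) *\<^sub>C (T l * adj b)" by (simp add: adj_mult adj_adj adj_scaleC)
  moreover have "c l * cnj (c l) = 1" using assms(4)[OF l] by (simp add: complex_norm_square[symmetric])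
  ultimately show ?thesis by (simp add: scaleC_scaleC)
qed

section \<open>Automorphisms fixing the smaller algebra\<close>

text \<open>The entry \<open>adj (S i) * Q * S k\<close> intertwines \<open>alpha k\<close> with
  \<open>alpha i\<close> on the fixed algebra. There lies \<open>V (2 * m)\<close>, whose images are
  spikes with repeated letters \<open>k\<close> and \<open>i\<close>; so the entry is a scalar, and
  zero off the diagonal.\<close>

lemma commutant_rho_fixed:
  fixes Q :: 'a
  assumes Q: "\<And>x. x \<in> fixed (- 1) \<Longrightarrow> Q * rho x = rho x * Q"
  obtains d where "\<And>i. i \<in> L \<Longrightarrow> adj (S i) * Q = d i *\<^sub>C adj (S i)"
    "\<And>i. i \<in> L \<Longrightarrow> Q * S i = d i *\<^sub>C S i"
proof -
  have entry: "\<exists>c. adj (S i) * Q * S k = c *\<^sub>C 1 \<and> (i \<noteq> k \<longrightarrow> c = 0)" if ik: "i \<in> L" "k \<in> L" for i k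
  proof -
    define y where "y = adj (S i) * Q * S k"
    have comm: "alpha i x * y = y * alpha k x" if "x \<in> fixed (- 1)" for x
    proof -
      have "alpha i x * y = adj (S i) * (rho x * Q) * S k"
        by (simp add: y_def adj_S_mult_rho ik flip: mult.assoc)
      also have "\<dots> = adj (S i) * (Q * rho x) * S k" using Q[OF that] by simp
      also have "\<dots> = y * alpha k x" by (simp add: y_def rho_mult_S ik mult.assoc)
      finally show ?thesis .
    qed
    have spike: "alpha j (V m) = spike j (sw j 2) m" if "j \<in> L" for j m
      using that letters
      by (simp add: V_def spike_def star_hom_simps[OF alpha_hom] alpha_S)
    have ne: "j \<noteq> sw j 2" for j by (simp add: sw_def)
    have "y = adj (spike i (sw i 2) (2 * m)) * y * spike k (sw k 2) (2 * m)" for m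
    proof -
      have "adj (spike i (sw i 2) (2 * m)) * (spike i (sw i 2) (2 * m) * y) = y"
        using spike_isometry[of i "sw i 2" "2 * m"] ik sw_in_L letters by (simp flip: mult.assoc)
      then show ?thesis
        using comm[OF V_even_fixed[of "- 1" m]] ik by (simp add: spike mult.assoc)
    qed
    then have per: "\<exists>m'\<ge>m. \<exists>c. cmod c = 1 \<and> y = c *\<^sub>C (adj (spike i (sw i 2) m') * y * spike k (sw k 2) m')" for m
      by (intro exI[of _ "2 * m"] conjI exI[of _ 1]) simp_all
    obtain c where "y = c *\<^sub>C 1" "i \<noteq> k \<Longrightarrow> c = 0"
      using spike_fixed_scalar[OF ik(1) sw_in_L[OF ik(1) letters(3)] ik(2) sw_in_L[OF ik(2) letters(3)] ne ne per]
      by blast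
    then show ?thesis unfolding y_def by blast
  qed
  then have "\<forall>i\<in>L. \<exists>c. adj (S i) * Q * S i = c *\<^sub>C 1" by blast
  from bchoice[OF this] obtain d where d: "\<forall>i\<in>L. adj (S i) * Q * S i = d i *\<^sub>C 1" by blast
  have off: "adj (S i) * Q * S k = (if k = i then d i *\<^sub>C 1 else 0)" if "i \<in> L" "k \<in> L" for i k
    using entry[OF that] d that by auto
  show thesis
  proof (rule that)
    fix i assume i: "i \<in> L"
    have "adj (S i) * Q = (\<Sum>k\<in>L. adj (S i) * Q * S k * adj (S k))"
      using S_sum by (simp add: mult.assoc flip: sum_distrib_left)
    also have "\<dots> = (\<Sum>k\<in>L. if k = i then d i *\<^sub>C adj (S i) else 0)"
      using off i by (intro sum.cong) (auto simp: mult_scaleC_left)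
    finally show "adj (S i) * Q = d i *\<^sub>C adj (S i)" using i finite_L by simp
    have "Q * S i = (\<Sum>k\<in>L. S k * adj (S k) * (Q * S i))"
      by (simp add: S_sum flip: sum_distrib_right)
    also have "\<dots> = (\<Sum>k\<in>L. if k = i then d i *\<^sub>C S i else 0)"
      using off i by (intro sum.cong) (auto simp: mult_scaleC_right mult.assoc)
    finally show "Q * S i = d i *\<^sub>C S i" using i finite_L by simp
  qed
qed

lemma fixes_rho_if_fixes_rho_fixed:
  assumes \<phi>: "star_hom \<phi>" "bij \<phi>" and fix_rho: "\<And>x. x \<in> fixed (- 1) \<Longrightarrow> \<phi> (rho x) = rho x"
  shows "\<phi> (rho x) = rho x"
proof -
  note \<phi>hom = star_hom_simps[OF \<phi>(1)]
  note rhom = star_hom_simps[OF rho_hom]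
  have th: "star_hom (theta (- 1))" by (rule theta_hom) simp
  note thom = star_hom_simps[OF th]
  have th1: "theta (- 1) (S 1) = - S 1" using letters by (simp add: theta_S)
  have S1S1: "adj (S 1) * (S 1 * z) = z" for z using letters by (simp add: S_orth')
  define v where "v = rho (S 1)"
  \<comment> \<open>\<open>Q\<close> measures how \<open>\<phi>\<close> moves the image of
    \<open>S 1\<close>, the only generator outside the fixed algebra.\<close>
  define Q where "Q = adj v * \<phi> v"
  have "Q * rho x = rho x * Q" if x: "x \<in> fixed (- 1)" for x
  proof -
    \<comment> \<open>Two sign changes cancel, so conjugation by \<open>S 1\<close> stays in the
      fixed algebra; this carries \<open>rho x\<close> past \<open>\<phi> v\<close>.\<close>
    have xx: "S 1 * x * adj (S 1) \<in> fixed (- 1)"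
      using x by (simp add: fixed_def thom th1[simplified] adj_uminus)
    have "\<phi> v * rho x = \<phi> (rho (S 1 * x))"
      by (simp add: \<phi>hom rhom v_def fix_rho[OF x])
    also have "S 1 * x = (S 1 * x * adj (S 1)) * S 1"
      using S1S1[of 1] by (simp add: mult.assoc)
    also have "\<phi> (rho \<dots>) = rho (S 1 * x * adj (S 1)) * \<phi> v"
      by (simp only: rhom(2)[of "S 1 * x * adj (S 1)"] \<phi>hom(2) fix_rho[OF xx] v_def)
    finally have "Q * rho x = adj v * rho (S 1 * x * adj (S 1)) * \<phi> v"
      by (simp add: Q_def mult.assoc)
    also have "adj v * rho (S 1 * x * adj (S 1)) = rho (adj (S 1) * (S 1 * x * adj (S 1)))"
      by (simp add: v_def rhom)
    also have "\<dots> = rho x * adj v" using S1S1 by (simp add: mult.assoc v_def rhom)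
    finally show ?thesis by (simp add: Q_def mult.assoc)
  qed
  then obtain d where d: "\<And>i. i \<in> L \<Longrightarrow> adj (S i) * Q = d i *\<^sub>C adj (S i)"
    "\<And>i. i \<in> L \<Longrightarrow> Q * S i = d i *\<^sub>C S i"
    using commutant_rho_fixed[of Q] by blast
  \<comment> \<open>Invariance of the range projection of \<open>S 1\<close> places
    \<open>\<phi> v\<close> in the range of \<open>v\<close>, whence
    \<open>\<phi> v = v * Q\<close>.\<close>
  have proj: "S 1 * adj (S 1) \<in> fixed (- 1)"
    by (simp add: fixed_def thom th1[simplified] adj_uminus)
  have "\<phi> v = \<phi> (rho (S 1 * adj (S 1)) * v)"
    using S1S1[of 1] by (simp add: v_def mult.assoc flip: rhom(2))
  then have \<phi>v: "\<phi> v = v * Q"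
    by (simp only: \<phi>hom(2) fix_rho[OF proj]) (simp add: v_def Q_def rhom mult.assoc)
  have vv: "adj v * v = 1" using S1S1[of 1] by (simp add: v_def flip: rhom(5) rhom(2) add: rhom(3))
  have QQ: "adj Q * Q = 1"
  proof -
    have "adj Q * Q = adj Q * (adj v * v) * Q" using vv by simp
    also have "\<dots> = adj (\<phi> v) * \<phi> v" by (simp add: \<phi>v adj_mult mult.assoc)
    also have "\<dots> = 1" using vv by (simp add: \<phi>hom(3) flip: \<phi>hom(5) \<phi>hom(2))
    finally show ?thesis .
  qed
  have unit: "cmod (d i) = 1" if i: "i \<in> L" for i
  proof -
    have "norm (Q * S i) = norm (S i)" by (rule norm_isometry_mult[OF QQ])
    then show ?thesis using i by (simp add: d norm_scaleC norm_isometry S_orth)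
  qed
  \<comment> \<open>The phase that \<open>\<phi> (rho (S m))\<close> acquires in the diagonal
    position \<open>i\<close>; only \<open>S 1\<close> acquires one.\<close>
  define c where "c i m = (if m = 1 then d i else 1)" for i m :: nat
  have c_unit: "cmod (c i m) = 1" if "i \<in> L" for i m using unit[OF that] by (simp add: c_def)
  have fix_S: "\<phi> (rho (S m)) = rho (S m)" if "m \<in> L" "m \<noteq> 1" for m
    using that by (intro fix_rho) (simp add: fixed_def theta_S)
  have \<phi>rho: "adj (S i) * \<phi> (rho (S m)) = c i m *\<^sub>C (S (sw i m) * adj (S i))" if im: "i \<in> L" "m \<in> L" for i m
  proof (cases "m = 1")
    case True
    have "adj (S i) * \<phi> (rho (S 1)) = adj (S i) * rho (S 1) * Q"
      using \<phi>v by (simp add: v_def mult.assoc)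
    also have "\<dots> = S (sw i 1) * (adj (S i) * Q)"
      using adj_S_mult_rho[OF im(1), of "S 1"] alpha_S[OF im(1) letters(1)] by (simp only: mult.assoc)
    finally show ?thesis using True d(1)[OF im(1)] by (simp add: c_def mult_scaleC_right)
  next
    case False
    then show ?thesis using fix_S im adj_S_mult_rho[of i "S m"] by (simp add: c_def alpha_S)
  qed
  \<comment> \<open>\<open>b\<close> is the matrix that expresses the \<open>\<phi> (S j)\<close>
    through the generators. Its entry \<open>b i j\<close> intertwines \<open>\<phi>\<close> with a
    quasi-free automorphism whose permutation is \<open>p i j\<close>.\<close>
  define b where "b i j = adj (S i) * \<phi> (S j)" for i j
  define p where "p i j l = sw i (sw j l)" for i j l
  have p: "p i j l \<in> L" if "i \<in> L" "j \<in> L" "l \<in> L" for i j l using that by (simp add: p_def sw_in_L)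
  have p_inj: "inj_on (p i j) L" for i j by (simp add: inj_on_def p_def sw_eq_iff)
  have T: "rels (\<lambda>l. \<phi> (S l))" by (rule rels_image[OF \<phi>(1) rels_S])
  have inter: "c i (sw j l) *\<^sub>C (S (p i j l) * b i j) = b i j * \<phi> (S l)"
    if ij: "i \<in> L" "j \<in> L" "l \<in> L" for i j l
  proof -
    have "c i (sw j l) *\<^sub>C (S (p i j l) * b i j) = adj (S i) * \<phi> (rho (S (sw j l))) * \<phi> (S j)"
      using \<phi>rho[of i "sw j l"] ij sw_in_L by (simp add: p_def b_def mult_scaleC_left mult.assoc)
    also have "\<dots> = adj (S i) * \<phi> (rho (S (sw j l)) * S j)" by (simp add: \<phi>hom(2) mult.assoc)
    also have "\<dots> = b i j * \<phi> (S l)"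
      using ij sw_in_L by (simp add: rho_mult_S alpha_S \<phi>hom(2) b_def mult.assoc)
    finally show ?thesis .
  qed
  have inter_adj: "c i (sw j l) *\<^sub>C (adj (b i j) * S (p i j l)) = \<phi> (S l) * adj (b i j)"
    if ij: "i \<in> L" "j \<in> L" "l \<in> L" for i j l
    using ij by (intro intertwiner_adj[OF T, where c = "\<lambda>l. c i (sw j l)"]) (auto simp: p p_inj c_unit inter)
  have row: "(\<Sum>j\<in>L. b i j * adj (b i j)) = 1" if "i \<in> L" for i
  proof -
    have "(\<Sum>j\<in>L. b i j * adj (b i j)) = adj (S i) * (\<Sum>j\<in>L. \<phi> (S j) * adj (\<phi> (S j))) * S i"
      by (simp add: b_def adj_mult adj_adj sum_distrib_left sum_distrib_right mult.assoc)
    also have "\<dots> = 1" using T that by (simp add: rels_def S_orth)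
    finally show ?thesis .
  qed
  have d1: "d r = 1" if r: "r \<in> L" for r
  proof (rule ccontr)
    assume "d r \<noteq> 1"
    obtain k where k: "k \<in> L" "k \<noteq> r" by (rule obtain_other_letter)
    have orth: "b r j * adj (b k l) = 0" if jl: "j \<in> L" "l \<in> L" for j l
    proof -
      have comm: "c r (sw j m) *\<^sub>C (S (p r j m) * (b r j * adj (b k l)))
          = c k (sw l m) *\<^sub>C (b r j * adj (b k l) * S (p k l m))" if m: "m \<in> L" for m
      proof -
        have "c r (sw j m) *\<^sub>C (S (p r j m) * (b r j * adj (b k l))) = b r j * \<phi> (S m) * adj (b k l)"
          unfolding inter[OF r jl(1) m, symmetric] by (simp add: mult_scaleC_left mult.assoc)
        also have "\<dots> = b r j * (c k (sw l m) *\<^sub>C (adj (b k l) * S (p k l m)))"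
          unfolding inter_adj[OF k(1) jl(2) m] by (simp add: mult.assoc)
        finally show ?thesis by (simp add: mult_scaleC_right mult.assoc)
      qed
      \<comment> \<open>The letter \<open>sw j 1\<close> is where row \<open>r\<close> carries the
        phase \<open>d r\<close>. For \<open>l = j\<close> the permutations send it to the different
        letters \<open>r\<close> and \<open>k\<close>; for \<open>l \<noteq> j\<close> row
        \<open>k\<close> has phase 1 there.\<close>
      have "p r j (sw j 1) \<noteq> p k l (sw j 1) \<or> c r (sw j (sw j 1)) \<noteq> c k (sw l (sw j 1))"
      proof (cases "sw l (sw j 1) = 1")
        case True
        then show ?thesis using k by (simp add: p_def)
      next
        case False
        then show ?thesis using \<open>d r \<noteq> 1\<close> by (simp add: c_def)
      qed
      then show ?thesis
        using r k jl sw_in_L letters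
        by (intro intertwiner(2)[where \<pi> = "p r j" and \<pi>' = "p k l" and l = "sw j 1"
              and c = "\<lambda>m. c r (sw j m)" and c' = "\<lambda>m. c k (sw l m)"])
          (auto simp: p p_inj c_unit comm)
    qed
    obtain l where l: "l \<in> L" "b k l \<noteq> 0"
      using row[OF k(1)] by (metis (no_types, lifting) mult_zero_left sum.neutral zero_neq_one)
    have "\<exists>q. adj (b k l) * b k l = q *\<^sub>C 1"
    proof -
      \<comment> \<open>Surjectivity of \<open>\<phi>\<close> enters here: the preimage of
        \<open>adj (b k l) * b k l\<close> commutes with all generators and is therefore a
        scalar.\<close>
      obtain g where g: "\<phi> g = adj (b k l) * b k l" using \<phi>(2) by (metis bij_pointE)
      have "S m * g = g * S m" if m: "m \<in> L" for m
      proof -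
        have "\<phi> (S m * g) = (c k (sw l m) *\<^sub>C (adj (b k l) * S (p k l m))) * b k l"
          unfolding inter_adj[OF k(1) l(1) m] by (simp add: \<phi>hom(2) g mult.assoc)
        also have "\<dots> = adj (b k l) * (c k (sw l m) *\<^sub>C (S (p k l m) * b k l))"
          by (simp add: mult_scaleC_left mult_scaleC_right mult.assoc)
        also have "\<dots> = \<phi> (g * S m)"
          unfolding inter[OF k(1) l(1) m] by (simp add: \<phi>hom(2) g mult.assoc)
        finally show ?thesis using \<phi>(2) by (simp add: bij_def inj_eq)
      qed
      then have "\<exists>q. g = q *\<^sub>C 1"
        by (intro intertwiner(1)[where \<pi> = "\<lambda>l. l" and \<pi>' = "\<lambda>l. l" and c = "\<lambda>l. 1" and c' = "\<lambda>l. 1"]) auto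
      then show ?thesis using g by (metis \<phi>hom(3,4))
    qed
    then obtain q where q: "adj (b k l) * b k l = q *\<^sub>C 1" by blast
    have "q \<noteq> 0" using q l(2) adj_mult_self_eq_0_iff[of "b k l"] by auto
    have "b r j = 0" if "j \<in> L" for j
    proof -
      have "q *\<^sub>C b r j = b r j * (adj (b k l) * b k l)" by (simp add: q mult_scaleC_right)
      also have "\<dots> = 0" using orth[OF that l(1)] by (simp flip: mult.assoc)
      finally show ?thesis using \<open>q \<noteq> 0\<close> by simp
    qed
    then show False using row[OF r] by simp
  qed
  have "Q = 1" by (rule eq_if_mult_S_eq) (simp add: d d1)
  then have "\<phi> (rho (S m)) = rho (S m)" if "m \<in> L" for m
    using fix_S[OF that] \<phi>v by (cases "m = 1") (auto simp: v_def)
  then have "(\<lambda>x. \<phi> (rho x)) = rho"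
    by (rule star_hom_eqI[OF star_hom_compose[OF \<phi>(1) rho_hom] rho_hom])
  then show ?thesis by metis
qed

lemma relative_aut_rho_fixed: "relative_aut (rho ` fixed (- 1)) = relative_aut (rho ` UNIV)"
proof
  show "relative_aut (rho ` fixed (- 1)) \<subseteq> relative_aut (rho ` UNIV)"
  proof
    fix \<phi> assume "\<phi> \<in> relative_aut (rho ` fixed (- 1))"
    then have \<phi>: "star_hom \<phi>" "bij \<phi>" "\<And>x. x \<in> fixed (- 1) \<Longrightarrow> \<phi> (rho x) = rho x"
      and "\<phi> \<in> cstar_aut"
      by (auto simp: relative_aut_def cstar_aut_def star_hom_def)
    then show "\<phi> \<in> relative_aut (rho ` UNIV)"
      using fixes_rho_if_fixes_rho_fixed[OF \<phi>] by (auto simp: relative_aut_def)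
  qed
qed (auto simp: relative_aut_def)

lemma fixed_proper: "S 1 \<notin> fixed (- 1)"
proof
  assume "S 1 \<in> fixed (- 1)"
  then have "S 1 = - S 1" using letters by (simp add: fixed_def theta_S)
  then have "2 *\<^sub>R S 1 = 0" by (metis add.right_inverse scaleR_2)
  then show False using S_nonzero[OF letters(1)] by simp
qed

end

theorem mainTheorem5:
  fixes n :: nat and S :: "nat \<Rightarrow> 'a::unital_cstar_algebra"
  assumes "n \<ge> 2" and "cuntz_algebra n S"
  shows "\<exists>B1 B2 :: 'a set.
    cstar_subalgebra B1 \<and> cstar_subalgebra B2 \<and>
    simple_cstar B1 \<and> simple_cstar B2 \<and>
    finite_watatani_index B1 \<and> finite_watatani_index B2 \<and>
    B1 \<subset> B2 \<and> relative_aut B1 = relative_aut B2"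
proof -
  interpret cuntz n S by unfold_locales (use assms in auto)
  have alg: "cstar_subalgebra (fixed (- 1))" "cstar_subalgebra (UNIV :: 'a set)"
    using cstar_subalgebra_fixed[of "- 1"] cstar_subalgebra_fixed[of 1] by (simp_all add: fixed_1)
  have simple: "simple_cstar (fixed (- 1))" "simple_cstar (UNIV :: 'a set)"
    using simple_fixed[of "- 1"] simple_fixed[of 1] by (simp_all add: fixed_1)
  have "rho (S 1) \<notin> rho ` fixed (- 1)"
    using fixed_proper by (auto simp: rho_inj simp del: One_nat_def)
  then have "rho ` fixed (- 1) \<subset> rho ` UNIV" by blast
  then show ?thesis
    using cstar_subalgebra_rho[OF alg(1)] cstar_subalgebra_rho[OF alg(2)]
      simple_rho[OF simple(1) alg(1)] simple_rho[OF simple(2) alg(2)]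
      finite_index_rho[OF finite_index_fixed] finite_index_rho[OF finite_index_UNIV]
      relative_aut_rho_fixed
    by blast
qed

end
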